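(* For every $s\in\mathbb{C}$ with $-\tfrac32<\operatorname{Re}(s)<-\tfrac12$, $$\zeta_\lambda(s)=\frac{1-2^{1-s}}{1-2^{1-2s}}\;\varphi(s)\int_0^\infty \mathcal{N}(x)\,x^{s-1/2}\,dx,$$ where $\zeta_\lambda$ is the meromorphic continuation to $\mathbb{C}$ of the Dirichlet series $\sum_{n\ge1}\lambda(n)n^{-s}$ of the Liouville function $\lambda$, $$\varphi(s)=\frac{2^{1-2s}}{\pi}\cos\Big(\frac{\pi}{2}s\Big)\cos\Big(\frac{\pi}{2}s+\frac{\pi}{4}\Big)\Gamma\Big(\frac12-s\Big),$$ and, for $x>0$, $$\mathcal{N}(x)=2x\sum_{m=0}^\infty\frac{\beta(2m+1)}{\sqrt{2m+1}\,\big(x^2+\pi^2(2m+1)^2\big)},$$ with $\beta$ the arithmetic function given on odd integers $2m+1=kh^2$ ($k$ squarefree, $h\ge1$) by $\beta(2m+1)=\mu(k)h$.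
   Context: $\lambda$ is the Liouville function: $\lambda(1)=1$, $\lambda(p)=-1$ for every prime $p$, and $\lambda(ab)=\lambda(a)\lambda(b)$ for all positive integers $a,b$. Its Dirichlet series $\zeta_\lambda(s)=\sum_{n=1}^\infty \lambda(n)n^{-s}$ ($\operatorname{Re}(s)>1$) equals $\zeta(2s)/\zeta(s)$, where $\zeta$ is the Riemann zeta function, and $\zeta_\lambda$ also denotes the meromorphic function $\zeta(2s)/\zeta(s)$ on $\mathbb{C}$. $\mu$ is the Möbius function and $\Gamma$ is Euler's Gamma function. Let $\zeta_{imp}(s)=\sum_{m=0}^\infty (2m+1)^{-s}$ for $\operatorname{Re}(s)>1$. The arithmetic function $\beta$ is defined by $\sum_{n\ge1}\beta(n)n^{-s}=\zeta_{imp}(2s-1)/\zeta_{imp}(s)$ for $\operatorname{Re}(s)>1$; explicitly, $\beta(n)=0$ for even $n$, and every odd $n$ is uniquely $n=kh^2$ with $k$ squarefree and $h\ge 1$, in which case $\beta(n)=\mu(k)h$. For $x>0$, $x^{s-1/2}=e^{(s-1/2)\log x}$ with the real logarithm. *)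

theory Defs
  imports
    "HOL-Complex_Analysis.Complex_Analysis"
    "HOL-Computational_Algebra.Computational_Algebra"
begin

definition liouville :: "nat \<Rightarrow> int" where
  "liouville n = (-1) ^ size (prime_factorization n)"

definition moebius :: "nat \<Rightarrow> int" where
  "moebius n = (if squarefree n then (-1) ^ card (prime_factors n) else 0)"

text \<open>
  For odd \<open>n = k * h\<^sup>2\<close> with \<open>k\<close> squarefree, \<open>squarefree_part n = k\<close> and \<open>square_part n = h\<close>;
  see \<open>beta_eq\<close> below.
\<close>
definition beta :: "nat \<Rightarrow> int" where
  "beta n = (if even n then 0 else moebius (squarefree_part n) * int (square_part n))"

lemma liouville_1: "liouville 1 = 1"
  by (simp add: liouville_def)

lemma liouville_prime: "prime p \<Longrightarrow> liouville p = -1"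
  by (simp add: liouville_def prime_factorization_prime)

lemma liouville_mult: "a > 0 \<Longrightarrow> b > 0 \<Longrightarrow> liouville (a * b) = liouville a * liouville b"
  by (simp add: liouville_def prime_factorization_mult power_add)

lemma liouville_unique:
  fixes f :: "nat \<Rightarrow> int"
  assumes "f 1 = 1" "\<And>p. prime p \<Longrightarrow> f p = -1"
    and "\<And>a b. a > 0 \<Longrightarrow> b > 0 \<Longrightarrow> f (a * b) = f a * f b"
    and "n > 0"
  shows "f n = liouville n"
  using \<open>n > 0\<close>
proof (induction n rule: prime_divisors_induct)
  case (unit n)
  then show ?case using assms(1) liouville_1 by simp
next
  case (factor p n)
  then show ?case
    using assms(2,3) liouville_prime liouville_mult prime_gt_0_nat by simp
qed auto

lemma beta_eq:
  fixes k h :: nat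
  assumes "squarefree k" "odd (k * h\<^sup>2)"
  shows "beta (k * h\<^sup>2) = moebius k * int h"
proof -
  have nz: "k \<noteq> 0" "h \<noteq> 0"
    using assms(2) by (auto intro!: Nat.gr0I)
  have "square_part (k * h\<^sup>2) = h"
  proof (rule multiplicity_eq_nat)
    show "square_part (k * h\<^sup>2) > 0" "h > 0"
      using nz by (simp_all add: gr0_conv_Suc del: not_gr_zero) (metis gr0_conv_Suc mult_is_0
          not_gr_zero power_eq_0_iff square_part_0_iff)+
  next
    fix p :: nat
    assume p: "prime p"
    have "multiplicity p k \<le> 1"
      using assms(1) p nz(1) squarefree_factorial_semiring'' by (metis One_nat_def)
    then show "multiplicity p (square_part (k * h\<^sup>2)) = multiplicity p h"
      using p nz
      by (simp add: prime_multiplicity_square_part prime_elem_multiplicity_mult_distrib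
          prime_elem_multiplicity_power_distrib)
  qed
  moreover from this have "squarefree_part (k * h\<^sup>2) = k"
    using squarefree_decompose[of "k * h\<^sup>2"] nz by simp
  ultimately show ?thesis
    using assms(2) by (simp add: beta_def)
qed

text \<open>
  \<open>nicely_meromorphic_on\<close> fixes the value at poles (to 0) and excludes removable
  singularities, which makes the continuation unique as a total function.
\<close>
definition liouville_continuation :: "(complex \<Rightarrow> complex) \<Rightarrow> bool" where
  "liouville_continuation f \<longleftrightarrow>
     f nicely_meromorphic_on UNIV \<and>
     (\<forall>s. Re s > 1 \<longrightarrow>
        (\<lambda>n. of_int (liouville (Suc n)) * of_nat (Suc n) powr (-s)) sums f s)"

definition zeta_liouville :: "complex \<Rightarrow> complex" where
  "zeta_liouville = (THE f. liouville_continuation f)"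

lemma liouville_continuation_unique:
  assumes "liouville_continuation f" "liouville_continuation g"
  shows "f = g"
proof
  fix z
  have nice: "f nicely_meromorphic_on UNIV" "g nicely_meromorphic_on UNIV"
    using assms by (auto simp: liouville_continuation_def)
  then have mero: "f meromorphic_on UNIV" "g meromorphic_on UNIV"
    by (auto simp: nicely_meromorphic_on_def)
  define d where "d = (\<lambda>w. f w - g w)"
  have d_mero: "d meromorphic_on UNIV"
    unfolding d_def using mero by (intro meromorphic_intros)
  have eq: "f s = g s" if "Re s > 1" for s
    using assms that sums_unique2 unfolding liouville_continuation_def by blast
  have "eventually (\<lambda>w. w \<in> {w. Re w > 1}) (at 2)"
    by (rule eventually_at_in_open') (auto simp: open_halfspace_Re_gt)
  then have ev2: "eventually (\<lambda>w. d w = 0) (at 2)"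
    by eventually_elim (auto simp: d_def eq)
  have "eventually (\<lambda>w. d w = 0) (cosparse UNIV) \<or> eventually (\<lambda>w. d w \<noteq> 0) (cosparse UNIV)"
    by (rule meromorphic_imp_constant_or_avoid[OF d_mero]) auto
  moreover have "\<not> eventually (\<lambda>w. d w \<noteq> 0) (cosparse UNIV)"
  proof
    assume "eventually (\<lambda>w. d w \<noteq> 0) (cosparse UNIV)"
    then have "eventually (\<lambda>w. d w \<noteq> 0) (at 2)"
      by (rule eventually_cosparse_imp_eventually_at) auto
    with ev2 have "eventually (\<lambda>w. False) (at (2::complex))"
      by eventually_elim auto
    then show False by simp
  qed
  ultimately have "eventually (\<lambda>w. d w = 0) (cosparse UNIV)"
    by blast
  then have "eventually (\<lambda>w. d w = 0) (at z)"
    by (rule eventually_cosparse_imp_eventually_at) auto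
  then have ev: "eventually (\<lambda>w. f w = g w) (at z)"
    by eventually_elim (auto simp: d_def)
  have pole: "is_pole f z \<longleftrightarrow> is_pole g z"
    by (rule is_pole_cong[OF ev refl])
  have f: "(is_pole f z \<and> f z = 0) \<or> f \<midarrow>z\<rightarrow> f z"
    and g: "(is_pole g z \<and> g z = 0) \<or> g \<midarrow>z\<rightarrow> g z"
    using nice by (auto simp: nicely_meromorphic_on_def)
  show "f z = g z"
  proof (cases "is_pole f z")
    case True
    then have "\<not> f \<midarrow>z\<rightarrow> f z" "\<not> g \<midarrow>z\<rightarrow> g z"
      using pole not_tendsto_and_filterlim_at_infinity[of "at z"] unfolding is_pole_def by auto
    with f g show ?thesis by auto
  next
    case False
    with f g pole have "f \<midarrow>z\<rightarrow> f z" "g \<midarrow>z\<rightarrow> g z" by auto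
    moreover from \<open>g \<midarrow>z\<rightarrow> g z\<close> have "f \<midarrow>z\<rightarrow> g z"
      using tendsto_cong[OF ev] by blast
    ultimately show ?thesis
      using tendsto_unique[of "at z"] by auto
  qed
qed

definition liouville_phi :: "complex \<Rightarrow> complex" where
  "liouville_phi s = 2 powr (1 - 2 * s) / of_real pi * cos (of_real pi / 2 * s)
             * cos (of_real pi / 2 * s + of_real pi / 4) * Gamma (1 / 2 - s)"

definition liouville_kernel_term :: "real \<Rightarrow> nat \<Rightarrow> real" where
  "liouville_kernel_term x m = of_int (beta (2 * m + 1)) /
     (sqrt (real (2 * m + 1)) * (x\<^sup>2 + pi\<^sup>2 * (real (2 * m + 1))\<^sup>2))"

definition liouville_kernel :: "real \<Rightarrow> real" where
  "liouville_kernel x = 2 * x * (\<Sum>m. liouville_kernel_term x m)"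

end

theory Submission imports Defs
begin

text \<open>
The integral is the Mellin transform of \<open>\<N>\<close> at \<open>s + 1/2\<close>, and \<open>\<N>\<close> is a superposition of
dilates of the single function \<open>g t = t / (1 + t\<^sup>2)\<close>: with \<open>a = 1 / (\<pi> n)\<close>, each summand
\<open>2 x / (x\<^sup>2 + \<pi>\<^sup>2 n\<^sup>2)\<close> equals \<open>2 a g (a x)\<close>. A Mellin transform turns dilation by \<open>a\<close> into
multiplication by \<open>a\<close> to the power \<open>-z\<close>, so it turns \<open>\<N>\<close> into the transform of \<open>g\<close>,
which is \<open>(\<pi>/2) / cos (\<pi> z / 2)\<close>, times the Dirichlet series of \<open>\<beta>\<close> at \<open>1 - s\<close>
(\<open>has_mellin_superposition\<close>, \<open>has_mellin_kernel\<close>, \<open>has_mellin_liouville_kernel\<close>).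

Every positive integer is \<open>k h\<^sup>2\<close> with a unique squarefree \<open>k\<close>. Since \<open>\<lambda>(k h\<^sup>2) = \<mu>(k)\<close>
and, when \<open>k h\<^sup>2\<close> is odd, \<open>\<beta>(k h\<^sup>2) = \<mu>(k) h\<close>, both Dirichlet series factor into the series of \<open>\<mu>\<close>, which is the
reciprocal of a zeta function, and a series over \<open>h\<close> (\<open>squarefree_square_series\<close>,
\<open>moebius_series_inverse\<close>). Hence the Liouville series is \<open>\<zeta>(2s) / \<zeta>(s)\<close>, and the series of
\<open>\<beta>\<close> at \<open>1 - s\<close> is \<open>\<zeta>(1 - 2s) / \<zeta>(1 - s)\<close> up to Euler factors at 2. The functional equation
of \<open>\<zeta>\<close> at \<open>s\<close> and at \<open>2s\<close>, together with Legendre duplication, relates the two quotients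
and produces the factor \<open>\<phi>\<close>; the Euler factors at 2 supply the quotient in front of it.

The continuation of \<open>\<zeta>\<close> rests on the same dilation principle. For \<open>Re s > 1\<close> the Bose function
\<open>1 / (exp t - 1)\<close>, a sum of dilates of \<open>exp (-t)\<close>, has Mellin transform \<open>\<Gamma>(s) \<zeta>(s)\<close>.
Subtracting its singular behaviour at 0 leaves an integral that is holomorphic for \<open>Re s > -1\<close>.
For \<open>-1 < Re s < 0\<close> the subtracted terms amount to replacing the Bose function by
\<open>1 / (exp t - 1) - 1/t + 1/2\<close>, and by the partial fractions of the cotangent this is again a sum of
dilates of \<open>g\<close>. Its transform therefore contains \<open>\<zeta>(1 - s)\<close>: this is the functional equation
(\<open>bose_tail_mellin_eq_zeta_series\<close>), and it also serves to extend \<open>\<zeta>\<close> to the rest of the plane.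
\<close>

section \<open>The Mellin transform and superposition of dilates\<close>

text \<open>
A relation, because the value of an integral alone does not record that it converges absolutely, and
every interchange below needs that.
\<close>

definition has_mellin :: "(real \<Rightarrow> complex) \<Rightarrow> complex \<Rightarrow> complex \<Rightarrow> bool" where
  "has_mellin f z I \<longleftrightarrow>
     has_bochner_integral lborel (\<lambda>t. indicator {0<..} t *\<^sub>R (of_real t powr (z - 1) * f t)) I"

lemma has_mellin_cong:
  assumes "\<And>t. t > 0 \<Longrightarrow> f t = g t"
  shows "has_mellin f z I \<longleftrightarrow> has_mellin g z I"
proof -
  have "(\<lambda>t. indicator {0<..} t *\<^sub>R (complex_of_real t powr (z - 1) * f t)) =
        (\<lambda>t. indicator {0<..} t *\<^sub>R (of_real t powr (z - 1) * g t))"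
    by (auto simp: fun_eq_iff assms indicator_def)
  then show ?thesis unfolding has_mellin_def by (rule arg_cong)
qed

lemma has_mellin_unique: "has_mellin f z I \<Longrightarrow> has_mellin f z J \<Longrightarrow> I = J"
  unfolding has_mellin_def by (rule has_bochner_integral_eq)

lemma has_mellin_add: "has_mellin f z I \<Longrightarrow> has_mellin g z J \<Longrightarrow> has_mellin (\<lambda>t. f t + g t) z (I + J)"
  unfolding has_mellin_def by (drule (1) has_bochner_integral_add) (simp add: algebra_simps)

lemma has_mellin_diff: "has_mellin f z I \<Longrightarrow> has_mellin g z J \<Longrightarrow> has_mellin (\<lambda>t. f t - g t) z (I - J)"
  unfolding has_mellin_def by (drule (1) has_bochner_integral_diff) (simp add: algebra_simps)

lemma has_mellin_cmult: "has_mellin f z I \<Longrightarrow> has_mellin (\<lambda>t. c * f t) z (c * I)"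
  unfolding has_mellin_def
  using has_bochner_integral_mult_right[where c = c and f = "\<lambda>t. indicator {0<..} t *\<^sub>R (of_real t powr (z - 1) * f t)"]
  by (simp add: mult_ac)

lemma has_mellin_powr_mult:
  "has_mellin (\<lambda>t. of_real t powr w * f t) z I \<longleftrightarrow> has_mellin f (z + w) I"
proof -
  have "indicator {0<..} t *\<^sub>R (complex_of_real t powr (z - 1) * (of_real t powr w * f t)) =
        indicator {0<..} t *\<^sub>R (of_real t powr (z + w - 1) * f t)" for t :: real
    by (simp add: powr_add[symmetric] algebra_simps)
  then show ?thesis unfolding has_mellin_def by (simp only:)
qed

lemma has_mellin_times_id:
  "has_mellin (\<lambda>t. of_real t * f t) z I \<longleftrightarrow> has_mellin f (z + 1) I"
  unfolding has_mellin_powr_mult[symmetric] by (rule has_mellin_cong) (simp add: powr_to_1)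

text \<open>
Fubini together with the substitution of \<open>t\<close> for \<open>a(u) t\<close>, under which the kernel \<open>t\<close> to the power
\<open>z - 1\<close> picks up the factor \<open>a(u)\<close> to the power \<open>-z\<close>. The measure is kept general so that one
statement covers infinite sums (counting measure) and integrals over dilations (Lebesgue measure).
\<close>

lemma has_mellin_superposition:
  fixes c :: "'a \<Rightarrow> complex" and a :: "'a \<Rightarrow> real"
  assumes M: "sigma_finite_measure M"
    and g: "has_mellin g z I"
    and a[measurable]: "a \<in> borel_measurable M" and a_pos: "\<And>u. u \<in> space M \<Longrightarrow> a u > 0"
    and c: "has_bochner_integral M (\<lambda>u. c u * of_real (a u) powr (-z)) J"
  shows "has_mellin (\<lambda>t. \<integral>u. c u * g (a u * t) \<partial>M) z (I * J)"
proof -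
  define G where "G = (\<lambda>t. indicator {0<..} t *\<^sub>R (complex_of_real t powr (z - 1) * g t))"
  define d where "d = (\<lambda>u. c u * of_real (a u) powr (-z))"
  have G: "has_bochner_integral lborel G I"
    using g unfolding has_mellin_def G_def .
  have d: "has_bochner_integral M d J" using c unfolding d_def .
  have [measurable]: "G \<in> borel_measurable borel"
    using borel_measurable_has_bochner_integral[OF G] by simp
  have [measurable]: "d \<in> borel_measurable M"
    using borel_measurable_has_bochner_integral[OF d] .
  interpret P: pair_sigma_finite M lborel
    by (intro pair_sigma_finite.intro M sigma_finite_lborel)
  \<comment> \<open>The measurability of \<open>g\<close> is known only through \<open>G\<close>, so Fubini is applied to an integrand written in terms of \<open>G\<close>.\<close>
  define F where "F = (\<lambda>u t. d u * of_real (a u) * G (a u * t))"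
  have scaled: "has_bochner_integral lborel (\<lambda>t. of_real (a u) * G (a u * t)) I"
    and scaled_norm: "has_bochner_integral lborel (\<lambda>t. a u * norm (G (a u * t))) (\<integral>t. norm (G t) \<partial>lborel)"
    if "u \<in> space M" for u
  proof -
    have "has_bochner_integral lborel (\<lambda>t. G (0 + a u * t)) (I /\<^sub>R \<bar>a u\<bar>)"
      using a_pos[OF that] by (subst lborel_has_bochner_integral_real_affine_iff[symmetric]) (auto intro: G)
    then have "has_bochner_integral lborel (\<lambda>t. of_real (a u) * G (0 + a u * t)) (of_real (a u) * (I /\<^sub>R \<bar>a u\<bar>))"
      by (rule has_bochner_integral_mult_right)
    then show "has_bochner_integral lborel (\<lambda>t. of_real (a u) * G (a u * t)) I"
      using a_pos[OF that] by (simp add: scaleR_conv_of_real flip: mult.assoc)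
    have "has_bochner_integral lborel (\<lambda>t. norm (G t)) (\<integral>t. norm (G t) \<partial>lborel)"
      using G by (simp add: has_bochner_integral_iff)
    then have "has_bochner_integral lborel (\<lambda>t. norm (G (0 + a u * t))) ((\<integral>t. norm (G t) \<partial>lborel) /\<^sub>R \<bar>a u\<bar>)"
      using a_pos[OF that] by (subst lborel_has_bochner_integral_real_affine_iff[symmetric]) auto
    then have "has_bochner_integral lborel (\<lambda>t. a u * norm (G (0 + a u * t))) (a u * ((\<integral>t. norm (G t) \<partial>lborel) /\<^sub>R \<bar>a u\<bar>))"
      by (rule has_bochner_integral_mult_right)
    then show "has_bochner_integral lborel (\<lambda>t. a u * norm (G (a u * t))) (\<integral>t. norm (G t) \<partial>lborel)"
      using a_pos[OF that] by (simp flip: mult.assoc)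
  qed
  have Fint: "has_bochner_integral lborel (F u) (d u * I)" if "u \<in> space M" for u
    using has_bochner_integral_mult_right[OF scaled[OF that], of "d u"]
    unfolding F_def by (simp add: mult_ac)
  have Fnorm: "(\<integral>t. norm (F u t) \<partial>lborel) = norm (d u) * (\<integral>t. norm (G t) \<partial>lborel)" if "u \<in> space M" for u
  proof -
    have "has_bochner_integral lborel (\<lambda>t. norm (d u) * (a u * norm (G (a u * t)))) (norm (d u) * (\<integral>t. norm (G t) \<partial>lborel))"
      by (intro has_bochner_integral_mult_right scaled_norm that)
    also have "(\<lambda>t. norm (d u) * (a u * norm (G (a u * t)))) = (\<lambda>t. norm (F u t))"
      using a_pos[OF that] by (simp add: F_def norm_mult mult_ac)
    finally show ?thesis by (simp add: has_bochner_integral_iff)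
  qed
  have Fprod: "integrable (M \<Otimes>\<^sub>M lborel) (case_prod F)"
  proof (rule P.Fubini_integrable)
    show "case_prod F \<in> borel_measurable (M \<Otimes>\<^sub>M lborel)"
      unfolding F_def by measurable
    show "integrable M (\<lambda>x. \<integral>y. norm (case_prod F (x, y)) \<partial>lborel)"
      using d by (simp add: Fnorm has_bochner_integral_iff cong: Bochner_Integration.integrable_cong)
    show "AE x in M. integrable lborel (\<lambda>y. case_prod F (x, y))"
      using Fint by (intro AE_I2) (auto simp: has_bochner_integral_iff)
  qed
  have eq: "(\<integral>u. F u t \<partial>M) =
      indicator {0<..} t *\<^sub>R (of_real t powr (z - 1) * (\<integral>u. c u * g (a u * t) \<partial>M))" for t
  proof (cases "t > 0")
    case False
    then have "F u t = 0" if "u \<in> space M" for u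
      using a_pos[OF that] by (auto simp: F_def G_def indicator_def zero_less_mult_iff)
    then have "(\<integral>u. F u t \<partial>M) = (\<integral>u. 0 \<partial>M)" by (intro Bochner_Integration.integral_cong) auto
    then show ?thesis using False by simp
  next
    case True
    have "F u t = of_real t powr (z - 1) * (c u * g (a u * t))" if "u \<in> space M" for u
    proof -
      have a: "a u > 0" by (rule a_pos[OF that])
      have "complex_of_real (a u * t) powr (z - 1) = of_real (a u) powr (z - 1) * of_real t powr (z - 1)"
        unfolding of_real_mult using a True by (subst powr_times_real) auto
      moreover have "complex_of_real (a u) powr (-z) * of_real (a u) * of_real (a u) powr (z - 1) = 1"
        using a by (simp add: powr_diff powr_minus)
      ultimately show ?thesis
        using a True by (simp add: F_def d_def G_def mult_ac)
    qed
    then have "(\<integral>u. F u t \<partial>M) = (\<integral>u. of_real t powr (z - 1) * (c u * g (a u * t)) \<partial>M)"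
      by (intro Bochner_Integration.integral_cong) auto
    then show ?thesis using True by simp
  qed
  have "(\<integral>t. (\<integral>u. F u t \<partial>M) \<partial>lborel) = (\<integral>u. (\<integral>t. F u t \<partial>lborel) \<partial>M)"
    by (rule P.Fubini_integral[OF Fprod])
  also have "\<dots> = (\<integral>u. d u * I \<partial>M)"
    using Fint by (intro Bochner_Integration.integral_cong) (auto simp: has_bochner_integral_iff)
  also have "\<dots> = I * J" using d by (simp add: has_bochner_integral_iff)
  finally have "has_bochner_integral lborel (\<lambda>t. \<integral>u. F u t \<partial>M) (I * J)"
    using P.integrable_snd[OF Fprod] by (simp add: has_bochner_integral_iff)
  then show ?thesis unfolding has_mellin_def eq .
qed

text \<open>
Absolute convergence of the transformed series gives convergence of the series of functions almost
everywhere only. The pointwise hypothesis makes the integral over the counting measure agree with the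
infinite sum at every \<open>t\<close>.
\<close>

lemma has_mellin_suminf:
  fixes c :: "nat \<Rightarrow> complex" and a :: "nat \<Rightarrow> real"
  assumes g: "has_mellin g z I" and a_pos: "\<And>n. a n > 0"
    and summ: "summable (\<lambda>n. norm (c n * of_real (a n) powr (-z)))"
    and pointwise: "\<And>t. t > 0 \<Longrightarrow> summable (\<lambda>n. norm (c n * g (a n * t)))"
  shows "has_mellin (\<lambda>t. \<Sum>n. c n * g (a n * t)) z (I * (\<Sum>n. c n * of_real (a n) powr (-z)))"
proof -
  have int: "integrable (count_space UNIV) f" if "summable (\<lambda>n. norm (f n))" for f :: "nat \<Rightarrow> complex"
    using that by (simp add: integrable_count_space_nat_iff)
  have "has_mellin (\<lambda>t. \<integral>n. c n * g (a n * t) \<partial>count_space UNIV) z (I * (\<Sum>n. c n * of_real (a n) powr (-z)))"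
  proof (rule has_mellin_superposition[OF _ g])
    show "sigma_finite_measure (count_space (UNIV :: nat set))"
      by (rule sigma_finite_measure_count_space)
    show "has_bochner_integral (count_space UNIV) (\<lambda>n. c n * of_real (a n) powr (-z))
            (\<Sum>n. c n * of_real (a n) powr (-z))"
      using int[OF summ] by (simp add: has_bochner_integral_iff integral_count_space_nat)
  qed (auto simp: a_pos)
  then show ?thesis
    by (subst (asm) has_mellin_cong[OF integral_count_space_nat[OF int[OF pointwise]]]) auto
qed

lemma has_bochner_integral_lborel_if_absolutely_integrable:
  fixes f :: "real \<Rightarrow> complex"
  assumes "f absolutely_integrable_on S" "S \<in> sets borel" "set_borel_measurable borel S f"
  shows "has_bochner_integral lborel (\<lambda>x. indicator S x *\<^sub>R f x) (integral S f)"
proof -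
  have m: "(\<lambda>x. indicator S x *\<^sub>R f x) \<in> borel_measurable lborel"
    using assms(3) by (simp add: set_borel_measurable_def)
  have "integrable lebesgue (\<lambda>x. indicator S x *\<^sub>R f x)"
    using assms(1) by (simp add: set_integrable_def)
  then have 1: "integrable lborel (\<lambda>x. indicator S x *\<^sub>R f x)"
    using integrable_completion[OF m] by simp
  moreover have "integral S f = (\<integral>x. indicator S x *\<^sub>R f x \<partial>lborel)"
    using integral_completion[OF m] set_lebesgue_integral_eq_integral(2)[OF assms(1)]
    by (simp add: set_lebesgue_integral_def)
  ultimately show ?thesis by (simp add: has_bochner_integral_iff)
qed

lemma absolutely_integrable_if_has_bochner_integral_lborel:
  fixes f :: "real \<Rightarrow> complex"
  assumes "has_bochner_integral lborel (\<lambda>x. indicator S x *\<^sub>R f x) I"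
  shows "f absolutely_integrable_on S" "integral S f = I"
proof -
  have int: "integrable lborel (\<lambda>x. indicator S x *\<^sub>R f x)"
    using assms by (simp add: has_bochner_integral_iff)
  then have m: "(\<lambda>x. indicator S x *\<^sub>R f x) \<in> borel_measurable lborel" by auto
  show 1: "f absolutely_integrable_on S"
    using integrable_completion[OF m] int by (simp add: set_integrable_def)
  show "integral S f = I"
    using integral_completion[OF m] set_lebesgue_integral_eq_integral(2)[OF 1] assms
    by (simp add: set_lebesgue_integral_def has_bochner_integral_iff)
qed

lemma has_mellin_square:
  assumes f: "has_mellin f z I" and [measurable]: "f \<in> borel_measurable borel"
  shows "has_mellin (\<lambda>t. f (t\<^sup>2)) (2 * z) (I / 2)"
proof -
  define h where "h = (\<lambda>t::real. of_real t powr (z - 1) * f t)"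
  have h: "h absolutely_integrable_on {0<..}" "integral {0<..} h = I"
    using absolutely_integrable_if_has_bochner_integral_lborel[of "{0<..}" h I] f
    unfolding has_mellin_def h_def by simp_all
  have img: "(\<lambda>t::real. t\<^sup>2) ` {0<..} = {0<..}"
  proof safe
    fix x :: real assume "0 < x"
    then show "x \<in> power2 ` {0<..}" by (intro image_eqI[of _ _ "sqrt x"]) auto
  qed auto
  have inj: "inj_on (\<lambda>t::real. t\<^sup>2) {0<..}" by (auto simp: inj_on_def power2_eq_iff)
  have der: "((\<lambda>t. t\<^sup>2) has_field_derivative 2 * x) (at x within {0<..})" for x :: real
    by (auto intro!: derivative_eq_intros)
  have S: "{0<..} \<in> sets (lebesgue :: real measure)" by simp
  let ?k = "\<lambda>t. \<bar>2 * t\<bar> *\<^sub>R h (t\<^sup>2)"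
  have k: "?k absolutely_integrable_on {0<..}" and ki: "integral {0<..} ?k = I"
    using has_absolute_integral_change_of_variables_real[OF S der inj, of h I] h
    unfolding img by auto
  have "has_bochner_integral lborel (\<lambda>t. indicator {0<..} t *\<^sub>R ?k t) I"
    unfolding ki[symmetric]
    by (rule has_bochner_integral_lborel_if_absolutely_integrable[OF k]) (auto simp: set_borel_measurable_def h_def)
  from has_bochner_integral_mult_right[OF this, of "1/2"]
  show ?thesis unfolding has_mellin_def 
  proof (rule has_bochner_integral_cong[THEN iffD1, rotated -1])
    fix t :: real
    show "1 / 2 * (indicator {0<..} t *\<^sub>R ?k t) =
         indicator {0<..} t *\<^sub>R (complex_of_real t powr (2 * z - 1) * f (t\<^sup>2))"
    proof (cases "t > 0")
      case True
      have "complex_of_real (t\<^sup>2) powr (z - 1) * of_real t = of_real t powr (2 * z - 1)"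
      proof -
        have "complex_of_real (t\<^sup>2) powr (z - 1) = of_real t powr (z - 1) * of_real t powr (z - 1)"
          unfolding power2_eq_square of_real_mult using True by (subst powr_times_real) auto
        also have "\<dots> * of_real t = of_real t powr ((z - 1) + (z - 1) + 1)"
          unfolding powr_add using True by simp
        also have "(z - 1) + (z - 1) + 1 = 2 * z - 1" by simp
        finally show ?thesis .
      qed
      then show ?thesis using True by (simp add: h_def scaleR_conv_of_real mult_ac)
    qed auto
  qed auto
qed

section \<open>Mellin transforms of elementary functions\<close>

lemma has_mellin_exp:
  assumes "Re z > 0"
  shows "has_mellin (\<lambda>t. of_real (exp (- t))) z (Gamma z)"
proof -
  have eq: "(\<lambda>t. complex_of_real t powr (z - 1) / of_real (exp t)) =
        (\<lambda>t. of_real t powr (z - 1) * of_real (exp (- t)))"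
    by (simp add: exp_minus divide_inverse)
  have "(\<lambda>t. complex_of_real t powr (z - 1) * of_real (exp (- t))) absolutely_integrable_on {0<..}"
    using absolutely_integrable_Gamma_integral'[OF assms] unfolding eq .
  from has_bochner_integral_lborel_if_absolutely_integrable[OF this]
  have "has_bochner_integral lborel (\<lambda>t. indicator {0<..} t *\<^sub>R (complex_of_real t powr (z - 1) * of_real (exp (- t))))
      (integral {0<..} (\<lambda>t. complex_of_real t powr (z - 1) * of_real (exp (- t))))"
    by (auto simp: set_borel_measurable_def)
  also have "integral {0<..} (\<lambda>t. complex_of_real t powr (z - 1) * of_real (exp (- t))) = Gamma z"
    using Gamma_integral_complex'[OF assms] unfolding eq by (rule integral_unique)
  finally show ?thesis unfolding has_mellin_def .
qed

text \<open>
The Mellin convolution theorem: the dilations \<open>u\<close> are weighted by \<open>c(u) du\<close>, and the factor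
\<open>u\<close> to the power \<open>-z\<close> is the Mellin kernel at \<open>1 - z\<close>.
\<close>

lemma has_mellin_convolution:
  assumes g: "has_mellin g z I" and c: "has_mellin c (1 - z) J"
  shows "has_mellin (\<lambda>t. LINT u:{0<..}|lborel. c u * g (u * t)) z (I * J)"
proof -
  have m: "{0<..} \<inter> space lborel \<in> sets (lborel :: real measure)" by simp
  have "has_mellin (\<lambda>t. \<integral>u. c u * g (u * t) \<partial>restrict_space lborel {0<..}) z (I * J)"
  proof (rule has_mellin_superposition[OF _ g])
    show "sigma_finite_measure (restrict_space lborel {0<..} :: real measure)"
      by (rule sigma_finite_measure_restrict_space[OF sigma_finite_lborel]) simp
    show "has_bochner_integral (restrict_space lborel {0<..}) (\<lambda>u. c u * of_real u powr (- z)) J"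
      using c by (simp add: has_bochner_integral_restrict_space[OF m] has_mellin_def mult_ac)
    show "(\<lambda>u. u) \<in> borel_measurable (restrict_space lborel {0<..})"
      by (simp add: measurable_restrict_space1)
  qed (auto simp: space_restrict_space)
  then show ?thesis
    by (simp add: integral_restrict_space[OF m] set_lebesgue_integral_def)
qed

text \<open>
\<open>1 / (1 + t)\<close> is the Laplace transform of \<open>exp (-u)\<close>, that is, the Mellin convolution of the
exponential with itself. So its transform is \<open>\<Gamma>(z) \<Gamma>(1 - z)\<close>, and the reflection formula applies.
\<close>

lemma has_mellin_inverse_1_plus:
  assumes "0 < Re z" "Re z < 1"
  shows "has_mellin (\<lambda>t. of_real (1 / (1 + t))) z (of_real pi / sin (of_real pi * z))"
proof -
  have eq: "(LINT u:{0<..}|lborel. complex_of_real (exp (-u)) * of_real (exp (- (u * t)))) = of_real (1 / (1 + t))"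
    if t: "t > 0" for t
  proof -
    have "has_mellin (\<lambda>t. of_real (exp (- t))) 1 1"
      using has_mellin_exp[of 1] by simp
    then have "has_bochner_integral lborel (\<lambda>u. indicator {0<..} u *\<^sub>R complex_of_real (exp (-u))) 1"
      unfolding has_mellin_def
      by (rule has_bochner_integral_cong[THEN iffD1, rotated -1]) (auto simp: indicator_def)
    then have "has_bochner_integral lborel (\<lambda>u. indicator {0<..} (0 + (1 + t) * u) *\<^sub>R complex_of_real (exp (-(0 + (1 + t) * u)))) (1 /\<^sub>R \<bar>1 + t\<bar>)"
      using t by (subst lborel_has_bochner_integral_real_affine_iff[symmetric]) auto
    then have "has_bochner_integral lborel (\<lambda>u. indicator {0<..} u *\<^sub>R (complex_of_real (exp (-u)) * of_real (exp (-(u * t))))) (of_real (1 / (1 + t)))"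
    proof (rule has_bochner_integral_cong[THEN iffD1, rotated -1])
      fix u :: real
      show "indicator {0<..} (0 + (1 + t) * u) *\<^sub>R complex_of_real (exp (- (0 + (1 + t) * u))) =
         indicator {0<..} u *\<^sub>R (complex_of_real (exp (- u)) * complex_of_real (exp (- (u * t))))"
      proof -
        have "0 < 0 + (1 + t) * u \<longleftrightarrow> 0 < u" using t by (simp add: zero_less_mult_iff)
        then have "indicat_real {0<..} (0 + (1 + t) * u) = indicator {0<..} u" by (simp add: indicator_def)
        moreover have "exp (- (0 + (1 + t) * u)) = exp (- u) * exp (- (u * t))"
          by (simp add: exp_add[symmetric] algebra_simps)
        ultimately show ?thesis by (simp only: of_real_mult)
      qed
      show "1 /\<^sub>R \<bar>1 + t\<bar> = complex_of_real (1 / (1 + t))"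
        using t by (simp add: scaleR_conv_of_real divide_inverse)
    qed auto
    then show ?thesis by (simp add: has_bochner_integral_iff set_lebesgue_integral_def)
  qed
  have "has_mellin (\<lambda>t. LINT u:{0<..}|lborel. complex_of_real (exp (-u)) * of_real (exp (- (u * t)))) z (Gamma z * Gamma (1 - z))"
    using assms by (intro has_mellin_convolution has_mellin_exp) auto
  then show ?thesis
    unfolding Gamma_reflection_complex by (subst (asm) has_mellin_cong[OF eq]) auto
qed

text \<open>
The case of \<open>1 / (1 + t)\<close> after \<open>t \<mapsto> t\<^sup>2\<close> and multiplication by \<open>t\<close>, which moves \<open>z\<close> to \<open>(z + 1) / 2\<close>.
\<close>

lemma has_mellin_kernel:
  assumes "-1 < Re z" "Re z < 1"
  shows "has_mellin (\<lambda>t. of_real (t / (1 + t\<^sup>2))) z (of_real pi / 2 / cos (of_real pi * z / 2))"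
proof -
  define v where "v = (z + 1) / 2"
  have v: "0 < Re v" "Re v < 1" "2 * v = z + 1" using assms by (simp_all add: v_def)
  have "has_mellin (\<lambda>t. of_real (1 / (1 + t\<^sup>2))) (2 * v) (of_real pi / sin (of_real pi * v) / 2)"
    by (rule has_mellin_square[OF has_mellin_inverse_1_plus[OF v(1,2)]]) measurable
  then have "has_mellin (\<lambda>t. of_real t * of_real (1 / (1 + t\<^sup>2))) z (of_real pi / sin (of_real pi * v) / 2)"
    unfolding has_mellin_times_id v .
  moreover have "sin (of_real pi * v) = cos (of_real pi * z / 2)"
  proof -
    have "of_real pi * v = of_real pi / 2 - (- (of_real pi * z / 2))" by (simp add: v_def field_simps)
    then have "sin (of_real pi * v) = sin (of_real pi / 2 - (- (of_real pi * z / 2)))" by (simp only:)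
    also have "\<dots> = cos (- (of_real pi * z / 2))"
      unfolding sin_diff by (simp add: sin_of_real[symmetric] cos_of_real[symmetric] flip: of_real_divide del: sin_of_real cos_of_real)
    finally show ?thesis by simp
  qed
  ultimately show ?thesis by (simp add: mult.commute)
qed

text \<open>
Domination by the convergent Gamma integral (\<open>exp (1 - t) \<ge> 1\<close> on the unit interval) gives absolute
convergence; the fundamental theorem of calculus gives the value.
\<close>

lemma has_mellin_indicator_Ioc:
  assumes "Re z > 0"
  shows "has_mellin (indicator {0<..1}) z (1 / z)"
proof -
  have m[measurable]: "(\<lambda>t. indicator {0<..1} t *\<^sub>R (complex_of_real t powr (z - 1))) \<in> borel_measurable lborel"
    by measurable
  have int: "integrable lborel (\<lambda>t. indicator {0<..1} t *\<^sub>R (complex_of_real t powr (z - 1)))"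
  proof (rule Bochner_Integration.integrable_bound)
    show "integrable lborel (\<lambda>t. exp 1 * (indicator {0<..} t *\<^sub>R (complex_of_real t powr (z - 1) * of_real (exp (- t)))))"
      using has_mellin_exp[OF assms] unfolding has_mellin_def has_bochner_integral_iff
      by (intro integrable_mult_right) auto
    show "AE t in lborel. norm (indicator {0<..1} t *\<^sub>R (complex_of_real t powr (z - 1)))
            \<le> norm (exp 1 * (indicator {0<..} t *\<^sub>R (complex_of_real t powr (z - 1) * of_real (exp (- t)))))"
    proof (intro AE_I2)
      fix t :: real
      have "norm (exp (1::complex)) = exp 1" using norm_exp_eq_Re[of 1] by simp
      moreover have "1 \<le> exp 1 * exp (- t)" if "t \<le> 1"
        using that by (simp add: exp_add[symmetric])
      ultimately show "norm (indicator {0<..1} t *\<^sub>R (complex_of_real t powr (z - 1)))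
            \<le> norm (exp 1 * (indicator {0<..} t *\<^sub>R (complex_of_real t powr (z - 1) * of_real (exp (- t)))))"
        by (auto simp: indicator_def norm_mult)
    qed
  qed (rule m)
  have "((\<lambda>t. complex_of_real t powr (z - 1)) has_integral
            (of_real 1 powr z / z - of_real 0 powr z / z)) {0..1}"
    using assms
    by (intro fundamental_theorem_of_calculus_interior)
       (auto intro!: continuous_intros derivative_eq_intros has_vector_derivative_real_field)
  then have hi: "((\<lambda>t. complex_of_real t powr (z - 1)) has_integral 1 / z) {0..1}" by simp
  have "((\<lambda>t. if t \<in> {0<..1} then complex_of_real t powr (z - 1) else 0) has_integral 1 / z) {0..1}"
    by (rule has_integral_spike[of "{0}", OF _ _ hi]) auto
  then have "((\<lambda>t. complex_of_real t powr (z - 1)) has_integral 1 / z) {0<..1}"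
    by (subst (asm) has_integral_restrict) auto
  then have "(LINT t:{0<..1}|lborel. complex_of_real t powr (z - 1)) = 1 / z"
    using set_borel_integral_eq_integral(2)[of "{0<..1}" "\<lambda>t. complex_of_real t powr (z - 1)"] int
    by (simp add: set_integrable_def integral_unique)
  then have "has_bochner_integral lborel (\<lambda>t. indicator {0<..1} t *\<^sub>R (complex_of_real t powr (z - 1))) (1 / z)"
    using int by (simp add: has_bochner_integral_iff set_lebesgue_integral_def)
  then show ?thesis unfolding has_mellin_def
    by (rule has_bochner_integral_cong[THEN iffD1, rotated -1]) (auto simp: indicator_def)
qed

text \<open>
Integration by parts without boundary terms: \<open>F t\<close> is the integral over \<open>0 < u < 1\<close> of
\<open>t f(ut)\<close>, a superposition of dilates of \<open>t f(t)\<close> with weight \<open>1/u\<close> on the unit interval, and that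
weight has transform \<open>-1/z\<close>.
\<close>

lemma has_mellin_antiderivative:
  fixes f F :: "real \<Rightarrow> real"
  assumes tf: "has_mellin (\<lambda>t. of_real (t * f t)) z I" and z: "Re z < 0"
    and F: "\<And>t. (F has_real_derivative f t) (at t)" "F 0 = 0" and f: "continuous_on UNIV f"
  shows "has_mellin (\<lambda>t. of_real (F t)) z (- I / z)"
proof -
  \<comment> \<open>The weight \<open>1/u\<close> on the unit interval, with transform \<open>-1/z\<close> at \<open>1 - z\<close>.\<close>
  define c where "c = (\<lambda>u::real. of_real u powr (-1) * indicator {0<..1} u :: complex)"
  have c: "has_mellin c (1 - z) (1 / - z)"
    unfolding c_def has_mellin_powr_mult using has_mellin_indicator_Ioc[of "- z"] z by simp
  have eq: "(LINT u:{0<..}|lborel. c u * of_real (u * t * f (u * t))) = of_real (F t)" for t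
  proof -
    have "has_bochner_integral lborel (\<lambda>u. indicator {0..1} u *\<^sub>R complex_of_real (t * f (u * t)))
       (of_real (F (1 * t)) - of_real (F (0 * t)))"
    proof (rule has_bochner_integral_FTC_Icc)
      fix u :: real
      have "((\<lambda>u. F (u * t)) has_real_derivative (t * f (u * t))) (at u within {0..1})"
        using DERIV_chain2[OF F(1), of "\<lambda>u. u * t" t u "{0..1}"] DERIV_cmult_right[OF DERIV_ident, of t u "{0..1}"]
        by (simp add: mult.commute)
      then show "((\<lambda>u. complex_of_real (F (u * t))) has_vector_derivative of_real (t * f (u * t))) (at u within {0..1})"
        by (rule has_vector_derivative_of_real)
    qed (auto intro!: continuous_intros continuous_on_compose2[OF f])
    then have "(\<integral>u. indicator {0..1} u *\<^sub>R complex_of_real (t * f (u * t)) \<partial>lborel) = of_real (F t)"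
      by (simp add: has_bochner_integral_iff F)
    also have "(\<integral>u. indicator {0..1} u *\<^sub>R complex_of_real (t * f (u * t)) \<partial>lborel) =
       (\<integral>u. indicator {0<..} u *\<^sub>R (c u * of_real (u * t * f (u * t))) \<partial>lborel)"
    proof (rule integral_cong_AE)
      have "AE u in lborel. u \<noteq> (0::real)" by (rule AE_lborel_singleton)
      then show "AE u in lborel. indicator {0..1} u *\<^sub>R complex_of_real (t * f (u * t)) =
          indicator {0<..} u *\<^sub>R (c u * of_real (u * t * f (u * t)))"
        by eventually_elim (auto simp: c_def indicator_def powr_minus field_simps)
      have [measurable]: "f \<in> borel_measurable borel" by (rule borel_measurable_continuous_onI[OF f])
      show "(\<lambda>u. indicator {0..1} u *\<^sub>R complex_of_real (t * f (u * t))) \<in> borel_measurable lborel" by measurable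
      show "(\<lambda>u. indicator {0<..} u *\<^sub>R (c u * of_real (u * t * f (u * t)))) \<in> borel_measurable lborel"
        unfolding c_def by measurable
    qed
    finally show ?thesis by (simp add: set_lebesgue_integral_def)
  qed
  show ?thesis using has_mellin_convolution[OF tf c] unfolding eq by simp
qed

lemma not_in_Ints_if_Re_between:
  fixes n :: int
  assumes "of_int n < Re z" "Re z < of_int (n + 1)"
  shows "z \<notin> \<int>"
proof
  assume "z \<in> \<int>"
  then obtain k where "z = of_int k" by (elim Ints_cases)
  then have "real_of_int n < of_int k" "real_of_int k < of_int (n + 1)" using assms by simp_all
  then show False unfolding of_int_less_iff by simp
qed

text \<open>
This result and \<open>has_mellin_exp_second_remainder\<close> below are the Cauchy-Saalschuetz integrals: left of the
strip of convergence, the Gamma integral still represents \<open>\<Gamma>\<close> once the Taylor polynomial of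
\<open>exp (-t)\<close> at 0 is subtracted.
\<close>

lemma has_mellin_1_minus_exp:
  assumes "-1 < Re z" "Re z < 0"
  shows "has_mellin (\<lambda>t. of_real (1 - exp (- t))) z (- Gamma z)"
proof -
  have "has_mellin (\<lambda>t. of_real (t * exp (- t))) z (Gamma (z + 1))"
    using has_mellin_exp[of "z + 1"] assms unfolding of_real_mult has_mellin_times_id by simp
  then have "has_mellin (\<lambda>t. of_real (1 - exp (- t))) z (- Gamma (z + 1) / z)"
    using assms(2) by (rule has_mellin_antiderivative) (auto intro!: derivative_eq_intros continuous_intros)
  moreover have "z \<notin> \<int>\<^sub>\<le>\<^sub>0" "z \<noteq> 0"
    using assms not_in_Ints_if_Re_between[of "-1" z] nonpos_Ints_subset_Ints by auto
  ultimately show ?thesis using Gamma_plus1[of z] by simp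
qed

lemma has_mellin_exp_second_remainder:
  assumes "-2 < Re z" "Re z < -1"
  shows "has_mellin (\<lambda>t. of_real (t - 1 + exp (- t))) z (Gamma z)"
proof -
  have "has_mellin (\<lambda>t. of_real (t * (1 - exp (- t)))) z (- Gamma (z + 1))"
    using has_mellin_1_minus_exp[of "z + 1"] assms unfolding of_real_mult has_mellin_times_id by simp
  then have "has_mellin (\<lambda>t. of_real (t - 1 + exp (- t))) z (- (- Gamma (z + 1)) / z)"
    using assms(2) by (intro has_mellin_antiderivative) (auto intro!: derivative_eq_intros continuous_intros)
  moreover have "z \<notin> \<int>\<^sub>\<le>\<^sub>0" "z \<noteq> 0"
    using assms not_in_Ints_if_Re_between[of "-2" z] nonpos_Ints_subset_Ints by auto
  ultimately show ?thesis using Gamma_plus1[of z] by simp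
qed

section \<open>Integrals that depend holomorphically on a parameter\<close>

text \<open>
Differentiation under the integral sign. By Cauchy's inequality the domination of \<open>f\<close> on a disc also
dominates its derivative on the concentric disc of half the radius, hence the difference quotients
there, and dominated convergence applies.
\<close>

lemma holomorphic_on_integral:
  fixes f :: "complex \<Rightarrow> 'a \<Rightarrow> complex"
  assumes holo: "\<And>t. t \<in> space M \<Longrightarrow> (\<lambda>z. f z t) holomorphic_on S"
    and meas: "\<And>z. z \<in> S \<Longrightarrow> f z \<in> borel_measurable M"
    and dominated: "\<And>z. z \<in> S \<Longrightarrow> \<exists>r>0. \<exists>g. cball z r \<subseteq> S \<and> integrable M g \<and>
       (\<forall>w\<in>cball z r. \<forall>t\<in>space M. norm (f w t) \<le> g t)"
  shows "(\<lambda>z. \<integral>t. f z t \<partial>M) holomorphic_on S"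
  unfolding holomorphic_on_def
proof
  fix z assume "z \<in> S"
  then obtain r g where r: "r > 0" "cball z r \<subseteq> S" and g: "integrable M g"
    and bound: "\<And>w t. w \<in> cball z r \<Longrightarrow> t \<in> space M \<Longrightarrow> norm (f w t) \<le> g t"
    using dominated by blast
  have fint: "integrable M (f w)" if "w \<in> cball z r" for w
    using g meas[of w] r(2) that bound[OF that] by (intro Bochner_Integration.integrable_bound[OF g])
      (auto intro!: AE_I2 order_trans[OF _ abs_ge_self])
  define D where "D = (\<lambda>t. deriv (\<lambda>z. f z t) z)"
  let ?C = "cball z (r / 2)"
  have sub: "cball w (r / 2) \<subseteq> cball z r" if "w \<in> ?C" for w
    using that by (intro cball_subset_cball_iff[THEN iffD2] disjI1) (auto simp: dist_commute)
  have der: "((\<lambda>z. f z t) has_field_derivative deriv (\<lambda>z. f z t) w) (at w)" if "w \<in> ball z r" "t \<in> space M" for w t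
  proof (rule holomorphic_derivI[of _ "ball z r"])
    show "(\<lambda>z. f z t) holomorphic_on ball z r"
      by (rule holomorphic_on_subset[OF holo[OF that(2)] order_trans[OF ball_subset_cball r(2)]])
  qed (use that in auto)
  have lip: "norm (f w t - f z t) \<le> g t / (r / 2) * norm (w - z)" if w: "w \<in> ?C" and t: "t \<in> space M" for w t
  proof (rule field_differentiable_bound[of ?C])
    fix v assume v: "v \<in> ?C"
    then show "((\<lambda>z. f z t) has_field_derivative deriv (\<lambda>z. f z t) v) (at v within ?C)"
      using r(1) t by (intro has_field_derivative_at_within[OF der]) auto
    have "norm ((deriv ^^ 1) (\<lambda>z. f z t) v) \<le> fact 1 * g t / (r / 2) ^ 1"
    proof (rule Cauchy_inequality)
      have "(\<lambda>z. f z t) holomorphic_on cball v (r / 2)"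
        by (rule holomorphic_on_subset[OF holo[OF t] order_trans[OF sub[OF v] r(2)]])
      then show "continuous_on (cball v (r / 2)) (\<lambda>z. f z t)" "(\<lambda>z. f z t) holomorphic_on ball v (r / 2)"
        by (auto intro: holomorphic_on_imp_continuous_on holomorphic_on_subset)
      show "norm (f x t) \<le> g t" if "norm (v - x) = r / 2" for x
        using sub[OF v] that by (intro bound t) (auto simp: dist_norm)
    qed (use r in auto)
    then show "norm (deriv (\<lambda>z. f z t) v) \<le> g t / (r / 2)" by simp
  qed (use w r in auto)
  have "((\<lambda>w. ((\<integral>t. f w t \<partial>M) - (\<integral>t. f z t \<partial>M)) / (w - z)) \<longlongrightarrow> (\<integral>t. D t \<partial>M)) (at z within ?C)"
    unfolding tendsto_at_iff_sequentially
  proof (intro allI impI)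
    fix X :: "nat \<Rightarrow> complex" assume X: "\<forall>i. X i \<in> ?C - {z}" and lim: "X \<longlonglongrightarrow> z"
    have Xr: "X i \<in> cball z r" for i
    proof -
      have "dist z (X i) \<le> r / 2" using X by auto
      then show ?thesis using r(1) by simp
    qed
    have zr: "z \<in> cball z r" using r by auto
    let ?q = "\<lambda>i t. (f (X i) t - f z t) / (X i - z)"
    have conv: "(\<lambda>i. ?q i t) \<longlonglongrightarrow> D t" if t: "t \<in> space M" for t
    proof -
      have "((\<lambda>w. (f w t - f z t) / (w - z)) \<longlongrightarrow> D t) (at z)"
        using der[of z t] t r unfolding D_def has_field_derivative_iff by auto
      moreover have "filterlim X (at z) sequentially"
        using X lim by (auto simp: filterlim_at)
      ultimately show ?thesis by (rule filterlim_compose)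
    qed
    have q_meas: "?q i \<in> borel_measurable M" for i
      using fint[OF Xr[of i]] fint[OF zr] by measurable
    have "(\<lambda>i. \<integral>t. ?q i t \<partial>M) \<longlonglongrightarrow> (\<integral>t. D t \<partial>M)"
    proof (rule integral_dominated_convergence)
      show "D \<in> borel_measurable M"
        by (rule borel_measurable_LIMSEQ_metric[OF q_meas conv])
      show "integrable M (\<lambda>t. g t / (r / 2))" using g by auto
      show "AE t in M. norm (?q i t) \<le> g t / (r / 2)" for i
      proof (intro AE_I2)
        fix t assume "t \<in> space M"
        then show "norm (?q i t) \<le> g t / (r / 2)"
          using lip[of "X i" t] X by (simp add: norm_divide divide_le_eq)
      qed
    qed (use conv q_meas in auto)
    moreover have "(\<integral>t. ?q i t \<partial>M) = ((\<integral>t. f (X i) t \<partial>M) - (\<integral>t. f z t \<partial>M)) / (X i - z)" for i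
      using fint[OF Xr[of i]] fint[OF zr] by simp
    ultimately show "((\<lambda>w. ((\<integral>t. f w t \<partial>M) - (\<integral>t. f z t \<partial>M)) / (w - z)) \<circ> X) \<longlonglongrightarrow> (\<integral>t. D t \<partial>M)"
      by (simp only: o_def)
  qed
  moreover have "at z within ?C = at z" using r by (intro at_within_interior) auto
  ultimately have "((\<lambda>z. \<integral>t. f z t \<partial>M) has_field_derivative (\<integral>t. D t \<partial>M)) (at z)"
    unfolding has_field_derivative_iff by (simp only:)
  then show "(\<lambda>z. \<integral>t. f z t \<partial>M) field_differentiable at z within S"
    unfolding field_differentiable_def by (intro exI) (rule has_field_derivative_at_within)
qed

text \<open>
On a disc the power of \<open>t\<close> is dominated by the sum of its values at the leftmost and rightmost points,
the first serving for \<open>t < 1\<close> and the second for \<open>t \<ge> 1\<close>.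
\<close>

lemma has_mellin_holomorphic:
  assumes F: "\<And>s. Re s > \<alpha> \<Longrightarrow> has_mellin f s (F s)"
  shows "F holomorphic_on {s. Re s > \<alpha>}"
proof -
  define k where "k = (\<lambda>s t. indicator {0<..} t *\<^sub>R (complex_of_real t powr (s - 1) * f t))"
  have k: "has_bochner_integral lborel (k s) (F s)" if "Re s > \<alpha>" for s
    using F[OF that] unfolding has_mellin_def k_def .
  have norm_k: "norm (k s t) = indicator {0<..} t * (t powr (Re s - 1) * norm (f t))" for s t
    by (auto simp: k_def norm_mult norm_powr_real_powr indicator_def)
  have "(\<lambda>s. \<integral>t. k s t \<partial>lborel) holomorphic_on {s. Re s > \<alpha>}"
  proof (rule holomorphic_on_integral)
    show "(\<lambda>s. k s t) holomorphic_on {s. Re s > \<alpha>}" for t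
      by (cases "t > 0") (auto simp: k_def intro!: holomorphic_intros)
    show "k s \<in> borel_measurable lborel" if "s \<in> {s. Re s > \<alpha>}" for s
      using k[of s] that borel_measurable_has_bochner_integral by auto
    fix s assume s: "s \<in> {s. Re s > \<alpha>}"
    define r where "r = (Re s - \<alpha>) / 2"
    have r: "r > 0" using s by (simp add: r_def)
    have Re_bounds: "Re s - r \<le> Re w" "Re w \<le> Re s + r" if "w \<in> cball s r" for w
      using that abs_Re_le_cmod[of "s - w"] by (auto simp: dist_norm abs_le_iff)
    let ?g = "\<lambda>t. norm (k (s - of_real r) t) + norm (k (s + of_real r) t)"
    have "integrable lborel ?g"
      using k[of "s - of_real r"] k[of "s + of_real r"] s r
      by (intro Bochner_Integration.integrable_add integrable_norm) (auto simp: has_bochner_integral_iff r_def field_simps)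
    moreover have "norm (k w t) \<le> ?g t" if w: "w \<in> cball s r" for w t
    proof (cases "t > 0")
      case True
      have "t powr (Re w - 1) \<le> t powr (Re s - r - 1) + t powr (Re s + r - 1)"
      proof (cases "t \<ge> 1")
        case True
        then have "t powr (Re w - 1) \<le> t powr (Re s + r - 1)" using Re_bounds[OF w] by (intro powr_mono) auto
        then show ?thesis by (simp add: add_increasing)
      next
        case False
        then have "t powr (Re w - 1) \<le> t powr (Re s - r - 1)"
          using Re_bounds[OF w] \<open>t > 0\<close> by (intro powr_mono') auto
        then show ?thesis by (simp add: add_increasing2)
      qed
      from mult_right_mono[OF this norm_ge_zero[of "f t"]] True
      show ?thesis by (simp add: norm_k algebra_simps)
    qed (simp add: norm_k)
    moreover have "cball s r \<subseteq> {s. Re s > \<alpha>}"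
    proof
      fix w assume "w \<in> cball s r"
      then show "w \<in> {s. Re s > \<alpha>}" using Re_bounds(1)[of w] s by (simp add: r_def field_simps)
    qed
    ultimately show "\<exists>r>0. \<exists>g. cball s r \<subseteq> {s. Re s > \<alpha>} \<and> integrable lborel g \<and>
       (\<forall>w\<in>cball s r. \<forall>t\<in>space lborel. norm (k w t) \<le> g t)"
      using r by blast
  qed
  then show ?thesis
    by (rule holomorphic_transform) (use k in \<open>auto simp: has_bochner_integral_iff\<close>)
qed


section \<open>Partial fractions\<close>

text \<open>
The logarithmic derivative of \<open>\<Gamma>(z) \<Gamma>(1 - z) = \<pi> / sin (\<pi> z)\<close>.
\<close>

lemma Digamma_reflection:
  fixes z :: complex
  assumes z: "z \<notin> \<int>"
  shows "Digamma (1 - z) - Digamma z = of_real pi * cot (of_real pi * z)"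
proof -
  have z': "z \<notin> \<int>\<^sub>\<le>\<^sub>0" "1 - z \<notin> \<int>\<^sub>\<le>\<^sub>0"
  proof -
    show "z \<notin> \<int>\<^sub>\<le>\<^sub>0" using z by auto
    have "1 - z \<in> \<int> \<Longrightarrow> z \<in> \<int>" using Ints_diff[of 1 "1 - z"] by simp
    then show "1 - z \<notin> \<int>\<^sub>\<le>\<^sub>0" using z by blast
  qed
  have sin: "sin (of_real pi * z) \<noteq> 0"
  proof
    assume "sin (of_real pi * z) = 0"
    then obtain n :: int where "of_real pi * z = of_real pi * of_int n"
      unfolding sin_eq_0 by (auto simp: mult.commute)
    then show False using z by simp
  qed
  have "((\<lambda>z. Gamma z * Gamma (1 - z)) has_field_derivative
      Gamma z * Gamma (1 - z) * (Digamma z - Digamma (1 - z))) (at z)"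
    using z' by (auto intro!: derivative_eq_intros simp: algebra_simps)
  moreover have "((\<lambda>z. of_real pi / sin (of_real pi * z)) has_field_derivative
      - (of_real pi * (of_real pi * cos (of_real pi * z)) / (sin (of_real pi * z))\<^sup>2)) (at z)"
    using sin by (auto intro!: derivative_eq_intros simp: field_simps power2_eq_square)
  ultimately have "Gamma z * Gamma (1 - z) * (Digamma z - Digamma (1 - z)) =
      - (of_real pi * (of_real pi * cos (of_real pi * z)) / (sin (of_real pi * z))\<^sup>2)"
    unfolding Gamma_reflection_complex by (rule DERIV_unique)
  then have "of_real pi / sin (of_real pi * z) * (Digamma z - Digamma (1 - z)) =
      of_real pi / sin (of_real pi * z) * (- (of_real pi * cot (of_real pi * z)))"
    unfolding Gamma_reflection_complex by (simp add: cot_def power2_eq_square)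
  then have "Digamma z - Digamma (1 - z) = - (of_real pi * cot (of_real pi * z))"
    using sin by (subst (asm) mult_left_cancel) auto
  then show ?thesis by (simp add: algebra_simps)
qed

text \<open>
Both Digamma values on the left of the reflection formula are limits of \<open>ln m\<close> minus a finite sum of
reciprocals. In the difference the logarithms cancel, and pairing the reciprocals of \<open>z + n + 1\<close> and
\<open>z - n - 1\<close> gives the summands.
\<close>

lemma cot_partial_fractions:
  fixes z :: complex
  assumes z: "z \<notin> \<int>"
  shows "(\<lambda>n. 2 * z / (z\<^sup>2 - (of_nat (Suc n))\<^sup>2)) sums (of_real pi * cot (of_real pi * z) - 1 / z)"
proof -
  have nz: "z + of_nat n \<noteq> 0" "of_nat n - z \<noteq> 0" "z - of_nat n \<noteq> 0" for n
    using z by (auto simp: add_eq_0_iff2 intro: Ints_minus)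
  \<comment> \<open>The second sum is the first reflected and shifted by one, so one boundary term is left over; it tends to 0.\<close>
  have partial: "(\<Sum>n<m. inverse (z + of_nat n)) - (\<Sum>n<m. inverse (1 - z + of_nat n)) - 1 / z + inverse (z + of_nat m) =
      (\<Sum>n<m. 2 * z / (z\<^sup>2 - (of_nat (Suc n))\<^sup>2))" for m
  proof (induction m)
    case (Suc m)
    have "inverse (z + of_nat (Suc m)) - inverse (1 - z + of_nat m) = 2 * z / (z\<^sup>2 - (of_nat (Suc m))\<^sup>2)"
    proof -
      have "1 - z + of_nat m = of_nat (Suc m) - z" by simp
      moreover have "z\<^sup>2 - (of_nat (Suc m))\<^sup>2 = (z + of_nat (Suc m)) * (z - of_nat (Suc m))"
        by (simp add: power2_eq_square algebra_simps)
      moreover have "inverse (z + w) - inverse (w - z) = 2 * z / ((z + w) * (z - w))"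
        if "z + w \<noteq> 0" "w - z \<noteq> 0" "z - w \<noteq> 0" for w
        using that by (simp add: divide_simps) (simp add: algebra_simps)
      ultimately show ?thesis using nz[of "Suc m"] by metis
    qed
    then show ?case using Suc.IH by (simp add: algebra_simps)
  qed (use nz[of 0] in \<open>simp add: inverse_eq_divide\<close>)
  have lim1: "(\<lambda>m. inverse (z + of_nat m)) \<longlonglongrightarrow> 0"
    by (rule tendsto_inverse_0[THEN filterlim_compose])
       (intro tendsto_add_filterlim_at_infinity[OF tendsto_const] tendsto_of_nat)
  have "(\<lambda>m. (of_real (ln (real m)) - (\<Sum>n<m. inverse (1 - z + of_nat n))) -
             (of_real (ln (real m)) - (\<Sum>n<m. inverse (z + of_nat n)))) \<longlonglongrightarrow> Digamma (1 - z) - Digamma z"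
    using nz[of 0] nz[of 1] by (intro tendsto_diff Digamma_LIMSEQ) auto
  then have "(\<lambda>m. (\<Sum>n<m. inverse (z + of_nat n)) - (\<Sum>n<m. inverse (1 - z + of_nat n))) \<longlonglongrightarrow> of_real pi * cot (of_real pi * z)"
    unfolding Digamma_reflection[OF z] by simp
  then have "(\<lambda>m. (\<Sum>n<m. inverse (z + of_nat n)) - (\<Sum>n<m. inverse (1 - z + of_nat n)) - 1 / z + inverse (z + of_nat m))
      \<longlonglongrightarrow> of_real pi * cot (of_real pi * z) - 1 / z + 0"
    by (intro tendsto_add tendsto_diff tendsto_const lim1)
  then show ?thesis unfolding sums_def partial by simp
qed

text \<open>
The cotangent expansion on the imaginary axis at \<open>z = i t / (2 \<pi>)\<close>, where the cotangent becomes a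
hyperbolic cotangent of \<open>t/2\<close>.
\<close>

lemma bose_partial_fractions:
  fixes t :: real
  assumes t: "t > 0"
  shows "(\<lambda>n. 2 * t / (t\<^sup>2 + (2 * pi * real (Suc n))\<^sup>2)) sums (1 / (exp t - 1) - 1 / t + 1 / 2)"
proof -
  define z where "z = \<i> * complex_of_real (t / (2 * pi))"
  have "Im z \<noteq> 0" using t by (simp add: z_def)
  then have "z \<notin> \<int>" by (auto elim!: Ints_cases)
  from cot_partial_fractions[OF this]
  have *: "(\<lambda>n. \<i> / of_real (2 * pi) * (2 * z / (z\<^sup>2 - (of_nat (Suc n))\<^sup>2))) sums
      (\<i> / of_real (2 * pi) * (of_real pi * cot (of_real pi * z) - 1 / z))"
    by (rule sums_mult)
  have "\<i> / of_real (2 * pi) * (2 * z / (z\<^sup>2 - (of_nat (Suc n))\<^sup>2)) =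
      of_real (2 * t / (t\<^sup>2 + (2 * pi * real (Suc n))\<^sup>2))" for n
  proof -
    define N where "N = real (Suc n)"
    have pos: "t\<^sup>2 + (2 * pi * N)\<^sup>2 > 0" using t by (intro add_pos_nonneg) auto
    have z2: "z\<^sup>2 = - of_real ((t / (2 * pi))\<^sup>2)" by (simp add: z_def power_mult_distrib power_divide)
    have "z\<^sup>2 - (of_nat (Suc n))\<^sup>2 = - of_real ((t\<^sup>2 + (2 * pi * N)\<^sup>2) / (2 * pi)\<^sup>2)"
      unfolding z2 N_def by (simp add: field_simps power2_eq_square)
    moreover have "\<i> / of_real p * (2 * (\<i> * of_real x) / (- of_real q)) = of_real (1 / p * (2 * x / q))" for p x q :: real
      by (cases "p = 0"; cases "q = 0") (simp_all add: field_simps)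
    ultimately have "\<i> / of_real (2 * pi) * (2 * z / (z\<^sup>2 - (of_nat (Suc n))\<^sup>2)) =
       of_real (1 / (2 * pi) * (2 * (t / (2 * pi)) / ((t\<^sup>2 + (2 * pi * N)\<^sup>2) / (2 * pi)\<^sup>2)))"
      by (simp only: z_def)
    also have "1 / (2 * pi) * (2 * (t / (2 * pi)) / ((t\<^sup>2 + (2 * pi * N)\<^sup>2) / (2 * pi)\<^sup>2)) = 2 * t / (t\<^sup>2 + (2 * pi * N)\<^sup>2)"
      using pos by (simp add: field_simps power2_eq_square)
    finally show ?thesis unfolding N_def .
  qed
  moreover have "\<i> / of_real (2 * pi) * (of_real pi * cot (of_real pi * z) - 1 / z) =
      of_real (1 / (exp t - 1) - 1 / t + 1 / 2)"
  proof -
    \<comment> \<open>Apart from the terms in \<open>1/t\<close>, both sides are rational functions of \<open>exp (t / 2)\<close>.\<close>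
    define E where "E = exp (t / 2)"
    have E: "E > 1" using t by (simp add: E_def)
    have E2: "exp t = E * E" by (simp add: E_def exp_add[symmetric])
    have e: "exp (\<i> * (of_real pi * z)) = of_real (1 / E)" "exp (- (\<i> * (of_real pi * z))) = of_real E"
      by (simp_all add: z_def E_def exp_minus exp_of_real[symmetric] field_simps)
    have "cot (of_real pi * z) = - \<i> * of_real ((E * E + 1) / (E * E - 1))"
    proof -
      have "cos (of_real pi * z) = of_real ((1 / E + E) / 2)"
        unfolding cos_exp_eq e by simp
      moreover have "sin (of_real pi * z) = \<i> * of_real ((E - 1 / E) / 2)"
        unfolding sin_exp_eq e by (simp add: field_simps)
      moreover have "(1 / E + E) / 2 / ((E - 1 / E) / 2) = (E * E + 1) / (E * E - 1)"
      proof -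
        have "1 / E + E = (E * E + 1) / E" "E - 1 / E = (E * E - 1) / E"
          using E by (simp_all add: field_simps)
        then show ?thesis using E by simp
      qed
      moreover have "a / (\<i> * b) = - \<i> * (a / b)" for a b :: complex
        by (cases "b = 0") (simp_all add: field_simps)
      ultimately show ?thesis unfolding cot_def by (simp only: of_real_divide[symmetric])
    qed
    moreover have "1 / z = - \<i> * of_real (2 * pi / t)"
      using t by (simp add: z_def field_simps)
    ultimately have "\<i> / of_real (2 * pi) * (of_real pi * cot (of_real pi * z) - 1 / z) =
       of_real (1 / (2 * pi) * (pi * ((E * E + 1) / (E * E - 1)) - 2 * pi / t))"
      by (simp add: algebra_simps flip: of_real_power of_real_add of_real_divide of_real_mult of_real_diff)
    also have "1 / (2 * pi) * (pi * ((E * E + 1) / (E * E - 1)) - 2 * pi / t) = 1 / (exp t - 1) - 1 / t + 1 / 2"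
    proof -
      have "E * E > 1" using E by (metis less_1_mult)
      then show ?thesis unfolding E2 using t by (simp add: field_simps)
    qed
    finally show ?thesis .
  qed
  ultimately show ?thesis using * by (simp only: sums_of_real_iff)
qed

section \<open>The Riemann zeta function and its functional equation\<close>

definition zeta_series :: "complex \<Rightarrow> complex" where
  "zeta_series s = (\<Sum>n. of_nat (Suc n) powr (- s))"

lemma norm_of_nat_Suc_powr [simp]: "norm (of_nat (Suc n) powr s) = real (Suc n) powr Re s"
  using norm_powr_real_powr[of "of_nat (Suc n)" s] by (simp del: of_nat_Suc)

lemma summable_zeta_series:
  assumes "Re s > 1"
  shows "summable (\<lambda>n. norm (of_nat (Suc n) powr (- s) :: complex))"
  using assms summable_real_powr_iff[of "- Re s"]
  unfolding norm_of_nat_Suc_powr by (subst summable_Suc_iff) auto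

definition bose :: "real \<Rightarrow> real" where
  "bose t = 1 / (exp t - 1)"

lemma bose_sums:
  assumes "t > 0"
  shows "(\<lambda>n. exp (- (real (Suc n) * t))) sums bose t"
proof -
  have "(\<lambda>n. exp (- t) ^ n) sums (1 / (1 - exp (- t)))"
    using assms by (intro geometric_sums) auto
  then have "(\<lambda>n. exp (- t) * exp (- t) ^ n) sums (exp (- t) * (1 / (1 - exp (- t))))"
    by (rule sums_mult)
  moreover have "exp (- t) * exp (- t) ^ n = exp (- (real (Suc n) * t))" for n
    by (simp add: exp_of_nat_mult[symmetric] exp_add[symmetric] algebra_simps)
  moreover have "exp (- t) * (1 / (1 - exp (- t))) = bose t"
    using assms by (simp add: bose_def exp_minus field_simps)
  ultimately show ?thesis by simp
qed

lemma has_mellin_bose: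
  assumes "Re s > 1"
  shows "has_mellin (\<lambda>t. of_real (bose t)) s (Gamma s * zeta_series s)"
proof -
  have "has_mellin (\<lambda>t. \<Sum>n. 1 * of_real (exp (- (real (Suc n) * t)))) s
      (Gamma s * (\<Sum>n. 1 * of_real (real (Suc n)) powr (- s)))"
  proof (rule has_mellin_suminf[OF has_mellin_exp])
    show "summable (\<lambda>n. norm (1 * complex_of_real (real (Suc n)) powr (- s)))"
      using summable_zeta_series[OF assms] by simp
    show "summable (\<lambda>n. norm (1 * complex_of_real (exp (- (real (Suc n) * t)))))" if "t > 0" for t
      using bose_sums[OF that] by (simp add: sums_iff)
  qed (use assms in auto)
  moreover have "(\<Sum>n. 1 * complex_of_real (exp (- (real (Suc n) * t)))) = of_real (bose t)" if "t > 0" for t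
    using bose_sums[OF that] by (simp add: sums_iff suminf_of_real[symmetric])
  ultimately show ?thesis
    by (subst (asm) has_mellin_cong[of _ "\<lambda>t. of_real (bose t)"]) (auto simp: zeta_series_def)
qed

text \<open>
The Bose function behaves like \<open>1/t - 1/2\<close> at 0. Subtracting \<open>exp (-t) / t + exp (-t) / 2\<close> removes
these two terms without spoiling the decay at infinity, and the Mellin transforms of the subtracted
functions are known values of \<open>\<Gamma>\<close>.
\<close>

definition bose_tail :: "real \<Rightarrow> real" where
  "bose_tail t = bose t - exp (- t) / t - exp (- t) / 2"

text \<open>
Near 0 the bound comes from the partial fractions, where every summand is at most a constant times
\<open>t / n\<^sup>2\<close>, and away from 0 from \<open>exp t \<ge> 2\<close>. A single dominating function \<open>t exp (-t)\<close> reduces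
convergence for \<open>Re s > -1\<close> to that of the Gamma integral at \<open>s + 1\<close>.
\<close>

lemma bose_tail_bound: "\<exists>C\<ge>0. \<forall>t>0. \<bar>bose_tail t\<bar> \<le> C * (t * exp (- t))"
proof -
  define K where "K = (\<Sum>n. 1 / (real (Suc n))\<^sup>2)"
  have summ: "summable (\<lambda>n. 1 / (real (Suc n))\<^sup>2)"
    using inverse_power_summable[of 2, where 'a = real] by (subst summable_Suc_iff) (simp add: inverse_eq_divide)
  have K: "K \<ge> 0" unfolding K_def by (intro suminf_nonneg summ) auto
  have small: "\<bar>bose_tail t\<bar> \<le> (K + 2) * t" if t: "t > 0" for t
  proof -
    let ?P = "bose t - 1 / t + 1 / 2"
    have P: "(\<lambda>n. 2 * t / (t\<^sup>2 + (2 * pi * real (Suc n))\<^sup>2)) sums ?P"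
      using bose_partial_fractions[OF t] by (simp add: bose_def)
    have "0 \<le> ?P" using t by (intro sums_le[OF _ sums_zero P]) auto
    moreover have "?P \<le> K * t"
    proof (rule sums_le[OF _ P])
      show "(\<lambda>n. 1 / (real (Suc n))\<^sup>2 * t) sums (K * t)"
        unfolding K_def by (intro sums_mult2 summable_sums summ)
      fix n
      define N where "N = real (Suc n)"
      have N: "N > 0" by (simp add: N_def)
      have "2 * N\<^sup>2 \<le> (2 * pi * N)\<^sup>2"
      proof -
        have "(2 * pi * N)\<^sup>2 = (4 * pi\<^sup>2) * N\<^sup>2" by (simp add: power_mult_distrib)
        moreover have "1 \<le> pi\<^sup>2" using pi_gt3 by (intro one_le_power) auto
        ultimately show ?thesis using mult_right_mono[of 2 "4 * pi\<^sup>2" "N\<^sup>2"] by simp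
      qed
      then have le: "2 * N\<^sup>2 \<le> t\<^sup>2 + (2 * pi * N)\<^sup>2" by (simp add: add_increasing)
      have "2 * t / (t\<^sup>2 + (2 * pi * N)\<^sup>2) \<le> 2 * t / (2 * N\<^sup>2)"
        using le t N by (intro divide_left_mono mult_pos_pos) (auto intro: add_pos_nonneg)
      then show "2 * t / (t\<^sup>2 + (2 * pi * real (Suc n))\<^sup>2) \<le> 1 / (real (Suc n))\<^sup>2 * t"
        unfolding N_def by simp
    qed
    moreover have "0 \<le> (t - 1 + exp (- t)) / t" using exp_ge_add_one_self[of "- t"] t by simp
    moreover have "(t - 1 + exp (- t)) / t \<le> t"
    proof -
      have "exp (- t) \<le> 1 / (1 + t)"
        using exp_ge_add_one_self[of t] t by (simp add: exp_minus field_simps)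
      also have "1 / (1 + t) \<le> 1 - t + t\<^sup>2"
      proof -
        have "(1 - t + t\<^sup>2) * (1 + t) = 1 + t ^ 3" by (simp add: algebra_simps power2_eq_square power3_eq_cube)
        then show ?thesis using t by (simp add: divide_le_eq)
      qed
      finally have "t - 1 + exp (- t) \<le> t * t" by (simp add: power2_eq_square)
      then show ?thesis using t by (simp add: divide_le_eq)
    qed
    moreover have "0 \<le> 1 - exp (- t)" "1 - exp (- t) \<le> t" using exp_ge_add_one_self[of "- t"] t by auto
    moreover have "bose_tail t = ?P - (t - 1 + exp (- t)) / t + (1 - exp (- t)) / 2"
      using t by (simp add: bose_tail_def field_simps)
    moreover have "\<bar>p - q + u / 2\<bar> \<le> K * t + 2 * t"
      if "0 \<le> p" "p \<le> K * t" "0 \<le> q" "q \<le> t" "0 \<le> u" "u \<le> t" for p q u :: real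
      using that by linarith
    ultimately show ?thesis unfolding distrib_right by metis
  qed
  have large: "\<bar>bose_tail t\<bar> \<le> 4 * exp (- t)" if t: "t \<ge> 1" for t
  proof -
    have "exp t \<ge> 2" using exp_ge_add_one_self[of t] t by linarith
    then have "1 / (exp t - 1) \<le> 1 / (exp t / 2)" by (intro frac_le) auto
    moreover have "bose t \<ge> 0" using t by (simp add: bose_def)
    moreover have "1 / (exp t / 2) = 2 * exp (- t)" by (simp add: exp_minus inverse_eq_divide)
    ultimately have "bose t \<le> 2 * exp (- t)" "bose t \<ge> 0" unfolding bose_def by (simp_all only:)
    moreover have "exp (- t) / t \<le> exp (- t)" "exp (- t) / t \<ge> 0" using t by (simp_all add: divide_le_eq)
    ultimately show ?thesis unfolding bose_tail_def using exp_gt_zero[of "- t"] by linarith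
  qed
  show ?thesis
  proof (intro exI[of _ "3 * (K + 2) + 4"] conjI allI impI)
    fix t :: real assume t: "t > 0"
    show "\<bar>bose_tail t\<bar> \<le> (3 * (K + 2) + 4) * (t * exp (- t))"
    proof (cases "t \<le> 1")
      case True
      have "exp t \<le> 3" using exp_le True by (meson exp_le_cancel_iff order_trans)
      then have "1 \<le> 3 * exp (- t)" by (simp add: exp_minus field_simps)
      then have "(K + 2) * t * 1 \<le> (K + 2) * t * (3 * exp (- t))"
        using K t by (intro mult_left_mono) auto
      also have "\<dots> \<le> (3 * (K + 2) + 4) * (t * exp (- t))" using t by (simp add: algebra_simps)
      finally show ?thesis using small[OF t] by simp
    next
      case False
      have "\<bar>bose_tail t\<bar> \<le> 4 * exp (- t)" using False by (intro large) simp
      also have "\<dots> \<le> 4 * (t * exp (- t))" using False by simp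
      also have "\<dots> \<le> (3 * (K + 2) + 4) * (t * exp (- t))"
        using K t by (intro mult_right_mono) auto
      finally show ?thesis .
    qed
  qed (use K in auto)
qed

definition bose_tail_mellin :: "complex \<Rightarrow> complex" where
  "bose_tail_mellin s =
     (LINT t:{0<..}|lborel. of_real t powr (s - 1) * of_real (bose_tail t))"

lemma has_mellin_bose_tail:
  assumes "Re s > -1"
  shows "has_mellin (\<lambda>t. of_real (bose_tail t)) s (bose_tail_mellin s)"
proof -
  obtain C where C: "C \<ge> 0" "\<And>t. t > 0 \<Longrightarrow> \<bar>bose_tail t\<bar> \<le> C * (t * exp (- t))"
    using bose_tail_bound by blast
  have "has_mellin (\<lambda>t. of_real C * of_real (t * exp (- t))) s (of_real C * Gamma (s + 1))"
    using has_mellin_exp[of "s + 1"] assms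
    by (intro has_mellin_cmult) (simp add: has_mellin_times_id)
  then have int: "integrable lborel (\<lambda>t. indicator {0<..} t *\<^sub>R
      (complex_of_real t powr (s - 1) * (of_real C * of_real (t * exp (- t)))))"
    by (simp add: has_mellin_def has_bochner_integral_iff)
  have "integrable lborel (\<lambda>t. indicator {0<..} t *\<^sub>R (complex_of_real t powr (s - 1) * of_real (bose_tail t)))"
  proof (rule Bochner_Integration.integrable_bound[OF int])
    show "(\<lambda>t. indicator {0<..} t *\<^sub>R (complex_of_real t powr (s - 1) * of_real (bose_tail t))) \<in> borel_measurable lborel"
      unfolding bose_tail_def bose_def by measurable
    show "AE t in lborel. norm (indicator {0<..} t *\<^sub>R (complex_of_real t powr (s - 1) * of_real (bose_tail t)))
       \<le> norm (indicator {0<..} t *\<^sub>R (complex_of_real t powr (s - 1) * (of_real C * of_real (t * exp (- t)))))"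
    proof (intro AE_I2)
      fix t :: real
      show "norm (indicator {0<..} t *\<^sub>R (complex_of_real t powr (s - 1) * of_real (bose_tail t)))
       \<le> norm (indicator {0<..} t *\<^sub>R (complex_of_real t powr (s - 1) * (of_real C * of_real (t * exp (- t)))))"
      proof (cases "t > 0")
        case True
        have "norm (complex_of_real (bose_tail t)) \<le> norm (complex_of_real C * of_real (t * exp (- t)))"
          using C(1) C(2)[OF True] True by (simp add: norm_mult)
        then show ?thesis using True by (simp add: norm_mult mult_left_mono)
      qed auto
    qed
  qed
  then show ?thesis
    by (simp add: has_mellin_def has_bochner_integral_iff bose_tail_mellin_def set_lebesgue_integral_def)
qed

lemma holomorphic_bose_tail_mellin: "bose_tail_mellin holomorphic_on {s. Re s > -1}"
  by (rule has_mellin_holomorphic[OF has_mellin_bose_tail])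

lemma rGamma_Gamma_minus_1:
  assumes "s \<noteq> 1" "s - 1 \<notin> \<int>\<^sub>\<le>\<^sub>0"
  shows "rGamma s * Gamma (s - 1) = 1 / (s - 1)"
proof -
  have "rGamma (s - 1) = (s - 1) * rGamma s" using rGamma_plus1[of "s - 1"] by simp
  moreover have "rGamma (s - 1) * Gamma (s - 1) = 1"
    using assms(2) by (simp add: Gamma_def rGamma_eq_zero_iff)
  ultimately have "(rGamma s * Gamma (s - 1)) * (s - 1) = 1" by (simp add: mult_ac)
  then show ?thesis using assms(1) by (subst eq_divide_eq) simp
qed

lemma zeta_series_eq_bose_tail_mellin:
  assumes "Re s > 1"
  shows "zeta_series s = rGamma s * bose_tail_mellin s + 1 / 2 + 1 / (s - 1)"
proof -
  have "has_mellin (\<lambda>t. of_real t powr (-1) * of_real (exp (- t))) s (Gamma (s - 1))"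
    unfolding has_mellin_powr_mult using has_mellin_exp[of "s - 1"] assms by simp
  then have m: "has_mellin (\<lambda>t. of_real (bose t) - of_real t powr (-1) * of_real (exp (- t)) - 1 / 2 * of_real (exp (- t))) s
      (Gamma s * zeta_series s - Gamma (s - 1) - 1 / 2 * Gamma s)"
    using assms by (intro has_mellin_diff has_mellin_cmult has_mellin_bose has_mellin_exp) auto
  have eq: "of_real (bose t) - complex_of_real t powr (-1) * of_real (exp (- t)) - 1 / 2 * of_real (exp (- t)) =
      of_real (bose_tail t)" if "t > 0" for t
    using that by (simp add: bose_tail_def powr_minus field_simps)
  have "has_mellin (\<lambda>t. of_real (bose_tail t)) s (Gamma s * zeta_series s - Gamma (s - 1) - 1 / 2 * Gamma s)"
    by (rule iffD1[OF has_mellin_cong[OF eq] m])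
  moreover have "has_mellin (\<lambda>t. of_real (bose_tail t)) s (bose_tail_mellin s)"
    using assms by (intro has_mellin_bose_tail) auto
  ultimately have eval: "bose_tail_mellin s = Gamma s * zeta_series s - Gamma (s - 1) - 1 / 2 * Gamma s"
    by (rule has_mellin_unique[symmetric])
  have "rGamma s * bose_tail_mellin s =
      rGamma s * Gamma s * zeta_series s - rGamma s * Gamma (s - 1) - 1 / 2 * (rGamma s * Gamma s)"
    unfolding eval by (simp add: algebra_simps)
  moreover have nz: "s \<noteq> 1" "s \<notin> \<int>\<^sub>\<le>\<^sub>0" "s - 1 \<notin> \<int>\<^sub>\<le>\<^sub>0"
    using assms by (auto elim!: nonpos_Ints_cases simp: complex_eq_iff)
  moreover have "rGamma s * Gamma s = 1" using nz by (simp add: Gamma_def rGamma_eq_zero_iff)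
  ultimately show ?thesis
    using rGamma_Gamma_minus_1[OF nz(1,3)] by (simp del: divide_eq_eq eq_divide_eq)
qed

lemma inverse_powr_minus:
  fixes b :: real
  assumes "b > 0"
  shows "complex_of_real (1 / b) powr (- s) = of_real b powr s"
proof -
  have "Ln (complex_of_real (1 / b)) = - Ln (of_real b)"
    using assms Ln_of_real[of b] Ln_of_real[of "1 / b"] by (simp add: ln_div)
  then show ?thesis using assms by (simp add: powr_def)
qed

text \<open>
In this strip the Mellin transforms of the functions subtracted in \<open>bose_tail\<close> no longer converge, but
those of the remainders \<open>(exp (-t) - 1 + t) / t\<close> and \<open>(exp (-t) - 1) / 2\<close> do and have the same values. So the left
side is the reciprocal of \<open>\<Gamma>(s)\<close> times the transform of \<open>1 / (exp t - 1) - 1/t + 1/2\<close>, which the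
partial fractions turn into \<open>\<zeta>(1 - s)\<close>. Rewriting that reciprocal by reflection cancels the cosine,
which leaves a formula without removable singularities in the whole half plane \<open>Re s < 0\<close>.
\<close>

lemma bose_tail_mellin_eq_zeta_series:
  assumes "-1 < Re s" "Re s < 0"
  shows "rGamma s * bose_tail_mellin s + 1 / 2 + 1 / (s - 1) =
    2 * (2 * of_real pi) powr (s - 1) * sin (of_real pi * s / 2) * Gamma (1 - s) * zeta_series (1 - s)"
proof -
  have nz: "s \<noteq> 1" "s \<notin> \<int>" "s - 1 \<notin> \<int>"
    using assms not_in_Ints_if_Re_between[of "-1" s] not_in_Ints_if_Re_between[of "-2" "s - 1"] by auto
  have nz': "s \<notin> \<int>\<^sub>\<le>\<^sub>0" "s - 1 \<notin> \<int>\<^sub>\<le>\<^sub>0" using nz nonpos_Ints_subset_Ints by auto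
  \<comment> \<open>With this \<open>a\<close> the partial fractions of the Bose function are dilates of \<open>t / (1 + t\<^sup>2)\<close> with coefficients \<open>2 a\<close>.\<close>
  define a where "a = (\<lambda>n. 1 / (2 * pi * real (Suc n)))"
  have a: "a n > 0" for n by (simp add: a_def)
  have a_powr: "of_real (2 * a n) * of_real (a n) powr (- s) = 2 * (2 * of_real pi) powr (s - 1) * of_nat (Suc n) powr (- (1 - s))" for n
  proof -
    have "complex_of_real (a n) = of_real (2 * pi * real (Suc n)) powr (- 1)"
      by (simp add: a_def powr_minus inverse_eq_divide)
    moreover have "complex_of_real (a n) powr (- s) = of_real (2 * pi * real (Suc n)) powr s"
      unfolding a_def by (rule inverse_powr_minus) simp
    ultimately have "of_real (2 * a n) * of_real (a n) powr (- s) = 2 * complex_of_real (2 * pi * real (Suc n)) powr (s - 1)"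
      by (simp add: powr_diff powr_minus field_simps)
    also have "complex_of_real (2 * pi * real (Suc n)) powr (s - 1) = of_real (2 * pi) powr (s - 1) * of_real (real (Suc n)) powr (s - 1)"
      unfolding of_real_mult[of "2 * pi"] by (subst powr_times_real) auto
    finally show ?thesis by simp
  qed
  have pointwise: "(\<lambda>n. 2 * a n * (a n * t / (1 + (a n * t)\<^sup>2))) sums (bose t - 1 / t + 1 / 2)" if "t > 0" for t
  proof -
    have key: "2 * t / (t\<^sup>2 + b\<^sup>2) = 2 * (1 / b) * (1 / b * t / (1 + (1 / b * t)\<^sup>2))" if "b > 0" for b
    proof -
      have "1 + (1 / b * t)\<^sup>2 = (t\<^sup>2 + b\<^sup>2) / b\<^sup>2"
        using that by (simp add: field_simps)
      then show ?thesis using that by (simp add: power2_eq_square)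
    qed
    have "2 * t / (t\<^sup>2 + (2 * pi * real (Suc n))\<^sup>2) = 2 * a n * (a n * t / (1 + (a n * t)\<^sup>2))" for n
      unfolding a_def by (rule key) simp
    then show ?thesis using bose_partial_fractions[OF that] by (simp only: bose_def)
  qed
  have m1: "has_mellin (\<lambda>t. \<Sum>n. of_real (2 * a n) * of_real (a n * t / (1 + (a n * t)\<^sup>2))) s
      (of_real pi / 2 / cos (of_real pi * s / 2) * (\<Sum>n. of_real (2 * a n) * of_real (a n) powr (- s)))"
  proof (rule has_mellin_suminf[OF has_mellin_kernel])
    show "summable (\<lambda>n. norm (of_real (2 * a n) * complex_of_real (a n) powr (- s)))"
      unfolding a_powr norm_mult using summable_zeta_series[of "1 - s"] assms by (intro summable_mult) auto
    show "summable (\<lambda>n. norm (of_real (2 * a n) * complex_of_real (a n * t / (1 + (a n * t)\<^sup>2))))" if "t > 0" for t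
    proof -
      have "norm (of_real (2 * a n) * complex_of_real (a n * t / (1 + (a n * t)\<^sup>2))) =
          2 * a n * (a n * t / (1 + (a n * t)\<^sup>2))" for n
        unfolding of_real_mult[symmetric] norm_of_real
        using a[of n] that by (intro abs_of_nonneg mult_nonneg_nonneg divide_nonneg_nonneg) auto
      then show ?thesis using pointwise[OF that] by (simp only: sums_iff)
    qed
  qed (use assms a in auto)
  have eq1: "(\<Sum>n. of_real (2 * a n) * complex_of_real (a n * t / (1 + (a n * t)\<^sup>2))) = of_real (bose t - 1 / t + 1 / 2)" if "t > 0" for t
    using pointwise[OF that] unfolding of_real_mult[symmetric] by (simp only: sums_iff suminf_of_real[symmetric])
  have m2: "has_mellin (\<lambda>t. of_real (bose_tail t) + of_real t powr (-1) * of_real (t - 1 + exp (- t)) - 1 / 2 * of_real (1 - exp (- t))) s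
      (bose_tail_mellin s + Gamma (s - 1) - 1 / 2 * - Gamma s)"
  proof (intro has_mellin_diff has_mellin_add has_mellin_cmult has_mellin_bose_tail has_mellin_1_minus_exp)
    show "has_mellin (\<lambda>t. of_real t powr (-1) * of_real (t - 1 + exp (- t))) s (Gamma (s - 1))"
      unfolding has_mellin_powr_mult using has_mellin_exp_second_remainder[of "s - 1"] assms by simp
  qed (use assms in auto)
  have eq2: "of_real (bose_tail t) + complex_of_real t powr (-1) * of_real (t - 1 + exp (- t)) - 1 / 2 * of_real (1 - exp (- t)) =
       of_real (bose t - 1 / t + 1 / 2)" if "t > 0" for t
    using that by (simp add: bose_tail_def powr_minus field_simps)
  have "bose_tail_mellin s + Gamma (s - 1) - 1 / 2 * - Gamma s =
      of_real pi / 2 / cos (of_real pi * s / 2) * (\<Sum>n. of_real (2 * a n) * of_real (a n) powr (- s))"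
    by (rule has_mellin_unique[OF iffD1[OF has_mellin_cong[OF eq2] m2] iffD1[OF has_mellin_cong[OF eq1] m1]])
  also have "(\<Sum>n. of_real (2 * a n) * complex_of_real (a n) powr (- s)) = 2 * (2 * of_real pi) powr (s - 1) * zeta_series (1 - s)"
    unfolding a_powr zeta_series_def
    by (rule suminf_mult[OF summable_norm_cancel[OF summable_zeta_series]]) (use assms in auto)
  finally have *: "rGamma s * (bose_tail_mellin s + Gamma (s - 1) + 1 / 2 * Gamma s) =
     rGamma s * (of_real pi / 2 / cos (of_real pi * s / 2)) * (2 * (2 * of_real pi) powr (s - 1) * zeta_series (1 - s))"
    by (simp add: mult.assoc)
  have sin_Gamma: "rGamma s * (of_real pi / 2 / cos (of_real pi * s / 2)) = sin (of_real pi * s / 2) * Gamma (1 - s)"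
  proof -
    have "1 - s \<notin> \<int>" using Ints_diff[of 1 "1 - s"] nz by auto
    then have s1: "1 - s \<notin> \<int>\<^sub>\<le>\<^sub>0" using nonpos_Ints_subset_Ints by auto
    have refl: "rGamma s * rGamma (1 - s) = sin (of_real pi * s) / of_real pi"
      by (rule rGamma_reflection_complex)
    have "rGamma (1 - s) * Gamma (1 - s) = 1" using s1 by (simp add: Gamma_def rGamma_eq_zero_iff)
    then have "rGamma s = rGamma s * rGamma (1 - s) * Gamma (1 - s)" by simp
    then have "rGamma s = sin (of_real pi * s) / of_real pi * Gamma (1 - s)" unfolding refl .
    moreover have "sin (of_real pi * s) \<noteq> 0"
      using refl s1 nz' by (auto simp: rGamma_eq_zero_iff)
    moreover have "sin (of_real pi * s) = 2 * sin (of_real pi * s / 2) * cos (of_real pi * s / 2)"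
      using sin_double[of "of_real pi * s / 2"] by simp
    ultimately show ?thesis by auto
  qed
  have one: "rGamma s * Gamma s = 1" using nz' by (simp add: Gamma_def rGamma_eq_zero_iff)
  have "rGamma s * bose_tail_mellin s + 1 / 2 + 1 / (s - 1) =
      rGamma s * bose_tail_mellin s + 1 / 2 * (rGamma s * Gamma s) + rGamma s * Gamma (s - 1)"
    by (simp only: one rGamma_Gamma_minus_1[OF nz(1) nz'(2)] mult_1_right)
  also have "\<dots> = rGamma s * (bose_tail_mellin s + Gamma (s - 1) + 1 / 2 * Gamma s)"
    by (simp only: algebra_simps)
  finally show ?thesis unfolding * sin_Gamma by (simp only: mult_ac)
qed

text \<open>
The half planes \<open>Re s > -1\<close> and \<open>Re s < 0\<close> overlap in the strip where both formulas are known to agree;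
the line \<open>Re s = -1/2\<close> inside it separates the two cases. The pole at 1 is split off so that
the remaining function is entire.
\<close>

definition zeta_regular_part :: "complex \<Rightarrow> complex" where
  "zeta_regular_part s =
     (if Re s > - 1 / 2 then rGamma s * bose_tail_mellin s + 1 / 2
      else 2 * (2 * of_real pi) powr (s - 1) * sin (of_real pi * s / 2) * Gamma (1 - s) * zeta_series (1 - s) - 1 / (s - 1))"

definition riemann_zeta :: "complex \<Rightarrow> complex" where
  "riemann_zeta s = zeta_regular_part s + 1 / (s - 1)"

lemma riemann_zeta_eq_series:
  assumes "Re s > 1"
  shows "riemann_zeta s = zeta_series s"
  using zeta_series_eq_bose_tail_mellin[OF assms] assms
  by (simp add: riemann_zeta_def zeta_regular_part_def)

lemma riemann_zeta_functional_equation: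
  assumes "Re s < 0"
  shows "riemann_zeta s =
    2 * (2 * of_real pi) powr (s - 1) * sin (of_real pi * s / 2) * Gamma (1 - s) * zeta_series (1 - s)"
proof (cases "Re s > - 1 / 2")
  case True
  then show ?thesis using bose_tail_mellin_eq_zeta_series[of s] assms
    by (simp add: riemann_zeta_def zeta_regular_part_def)
next
  case False
  then show ?thesis by (simp add: riemann_zeta_def zeta_regular_part_def)
qed

lemma holomorphic_zeta_series: "zeta_series holomorphic_on {s. Re s > 1}"
proof -
  have "(\<lambda>s. rGamma s * bose_tail_mellin s + 1 / 2 + 1 / (s - 1)) holomorphic_on {s. Re s > 1}"
    by (intro holomorphic_intros holomorphic_on_subset[OF holomorphic_bose_tail_mellin]) auto
  then show ?thesis
    by (rule holomorphic_transform) (simp add: zeta_series_eq_bose_tail_mellin)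
qed

lemma holomorphic_zeta_regular_part: "zeta_regular_part holomorphic_on UNIV"
proof -
  have "zeta_regular_part holomorphic_on {s. Re s > -1} \<union> {s. Re s < 0}"
  proof (rule holomorphic_on_Un)
    have "(\<lambda>s. rGamma s * bose_tail_mellin s + 1 / 2) holomorphic_on {s. Re s > -1}"
      by (intro holomorphic_intros holomorphic_bose_tail_mellin)
    then show "zeta_regular_part holomorphic_on {s. Re s > -1}"
    proof (rule holomorphic_transform)
      fix s assume "s \<in> {s. Re s > -1}"
      then show "rGamma s * bose_tail_mellin s + 1 / 2 = zeta_regular_part s"
        using bose_tail_mellin_eq_zeta_series[of s]
        by (cases "Re s > - 1 / 2") (simp_all add: zeta_regular_part_def eq_diff_eq)
    qed
    have "zeta_series \<circ> (\<lambda>s. 1 - s) holomorphic_on {s. Re s < 0}"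
      by (rule holomorphic_on_compose_gen[OF _ holomorphic_zeta_series]) (auto intro!: holomorphic_intros)
    moreover have "1 - s \<notin> \<int>\<^sub>\<le>\<^sub>0" if "Re s < 0" for s
      using that by (auto elim!: nonpos_Ints_cases simp: complex_eq_iff)
    ultimately have "(\<lambda>s. 2 * (2 * of_real pi) powr (s - 1) * sin (of_real pi * s / 2) * Gamma (1 - s) * zeta_series (1 - s) - 1 / (s - 1))
        holomorphic_on {s. Re s < 0}"
      unfolding o_def by (intro holomorphic_intros) auto
    then show "zeta_regular_part holomorphic_on {s. Re s < 0}"
    proof (rule holomorphic_transform)
      fix s assume "s \<in> {s. Re s < 0}"
      then show "2 * (2 * of_real pi) powr (s - 1) * sin (of_real pi * s / 2) * Gamma (1 - s) * zeta_series (1 - s) - 1 / (s - 1) =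
          zeta_regular_part s"
        using riemann_zeta_functional_equation[of s, symmetric] by (simp add: riemann_zeta_def diff_eq_eq)
    qed
  qed (auto simp: open_halfspace_Re_gt open_halfspace_Re_lt)
  moreover have "{s. Re s > -1} \<union> {s. Re s < 0} = UNIV" by auto
  ultimately show ?thesis by (simp only:)
qed

lemma riemann_zeta_analytic: "s \<noteq> 1 \<Longrightarrow> riemann_zeta analytic_on {s}"
proof -
  assume "s \<noteq> 1"
  have "(\<lambda>s. zeta_regular_part s + 1 / (s - 1)) analytic_on {s}"
    using \<open>s \<noteq> 1\<close> holomorphic_zeta_regular_part
    by (intro analytic_intros) (auto simp: analytic_on_open intro: analytic_on_subset[of _ UNIV])
  then show ?thesis by (simp add: riemann_zeta_def[abs_def])
qed

lemma riemann_zeta_meromorphic: "riemann_zeta meromorphic_on UNIV"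
proof -
  have "zeta_regular_part meromorphic_on UNIV"
    using holomorphic_zeta_regular_part by (intro analytic_on_imp_meromorphic_on) (simp add: analytic_on_open)
  then have "(\<lambda>s. zeta_regular_part s + 1 / (s - 1)) meromorphic_on UNIV"
    by (intro meromorphic_intros)
  then show ?thesis by (simp add: riemann_zeta_def[abs_def])
qed

section \<open>The Dirichlet series of the Liouville function and of beta\<close>

abbreviation norm_summable :: "('a \<Rightarrow> complex) \<Rightarrow> 'a set \<Rightarrow> bool" where
  "norm_summable f A \<equiv> (\<lambda>x. norm (f x)) summable_on A"

lemma has_sum_product:
  fixes x :: "'a \<Rightarrow> complex" and y :: "'b \<Rightarrow> complex"
  assumes x: "norm_summable x A" and y: "norm_summable y B"
  shows "norm_summable (\<lambda>(a, b). x a * y b) (A \<times> B)"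
    and "((\<lambda>(a, b). x a * y b) has_sum infsum x A * infsum y B) (A \<times> B)"
proof -
  show 1: "norm_summable (\<lambda>(a, b). x a * y b) (A \<times> B)"
    unfolding Infinite_Sum.abs_summable_on_Sigma_iff using x y
    by (auto simp: norm_mult infsum_cmult_right' abs_mult intro!: summable_on_cmult_right summable_on_cmult_left)
  show "((\<lambda>(a, b). x a * y b) has_sum infsum x A * infsum y B) (A \<times> B)"
  proof (rule has_sum_SigmaI)
    show "((\<lambda>b. (\<lambda>(a, b). x a * y b) (a, b)) has_sum x a * infsum y B) B" for a
      unfolding prod.case by (intro has_sum_cmult_right has_sum_infsum abs_summable_summable[OF y])
    show "((\<lambda>a. x a * infsum y B) has_sum infsum x A * infsum y B) A"
      by (intro has_sum_cmult_left has_sum_infsum abs_summable_summable[OF x])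
    show "(\<lambda>(a, b). x a * y b) summable_on A \<times> B"
      by (rule abs_summable_summable[OF 1])
  qed
qed

lemma moebius_prime_mult:
  assumes "prime p" "\<not> p dvd d" "squarefree d"
  shows "squarefree (p * d)" "moebius (p * d) = - moebius d"
proof -
  have "coprime p d" using assms by (simp add: prime_imp_coprime)
  then show sqf: "squarefree (p * d)"
    by (rule squarefree_mult_coprime[OF _ squarefree_prime[OF assms(1)] assms(3)])
  have "d \<noteq> 0" "p \<noteq> 0" using assms by (auto intro!: Nat.gr0I)
  then have "prime_factors (p * d) = insert p (prime_factors d)"
    using assms(1) by (simp add: prime_factors_product prime_factorization_prime)
  moreover have "p \<notin> prime_factors d" using assms by auto
  ultimately show "moebius (p * d) = - moebius d" using sqf assms by (simp add: moebius_def)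
qed

text \<open>
For a prime \<open>p\<close> dividing \<open>n\<close>, multiplication by \<open>p\<close> pairs the squarefree divisors prime to \<open>p\<close> with
the other squarefree divisors and changes the sign of \<open>\<mu>\<close>.
\<close>

lemma sum_moebius_divisors:
  assumes "n > 0"
  shows "(\<Sum>d | d dvd n. moebius d) = (if n = 1 then 1 else 0)"
proof (cases "n = 1")
  case True
  then show ?thesis by (simp add: moebius_def)
next
  case False
  then obtain p where p: "prime p" "p dvd n" using prime_factor_nat by blast
  define S where "S = {d. d dvd n \<and> squarefree d \<and> \<not> p dvd d}"
  have fin: "finite {d. d dvd n}" using assms by simp
  have split: "{d. d dvd n \<and> squarefree d} = S \<union> (*) p ` S"
  proof (intro equalityI subsetI)
    fix d assume d: "d \<in> {d. d dvd n \<and> squarefree d}"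
    show "d \<in> S \<union> (*) p ` S"
    proof (cases "p dvd d")
      case True
      then obtain e where e: "d = p * e" by blast
      have "\<not> p dvd e"
      proof
        assume "p dvd e"
        then have "p\<^sup>2 dvd d" unfolding e power2_eq_square by simp
        then show False using d squarefreeD[of d p] p(1) by auto
      qed
      moreover have "squarefree e" using d squarefree_multD[of p e] e by simp
      moreover have "e dvd n" using d e dvd_trans[of e d n] by simp
      ultimately show ?thesis using e unfolding S_def by blast
    qed (use d in \<open>auto simp: S_def\<close>)
  next
    fix d assume "d \<in> S \<union> (*) p ` S"
    then show "d \<in> {d. d dvd n \<and> squarefree d}"
      using p moebius_prime_mult(1)[OF p(1)] 
      by (auto simp: S_def intro!: divides_mult prime_imp_coprime)
  qed
  have "(\<Sum>d | d dvd n. moebius d) = (\<Sum>d | d dvd n \<and> squarefree d. moebius d)"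
    using fin by (intro sum.mono_neutral_right) (auto simp: moebius_def)
  also have "\<dots> = (\<Sum>d\<in>S. moebius d) + (\<Sum>d\<in>(*) p ` S. moebius d)"
    unfolding split using fin by (intro sum.union_disjoint) (auto simp: S_def)
  also have "(\<Sum>d\<in>(*) p ` S. moebius d) = (\<Sum>d\<in>S. moebius (p * d))"
    using p(1) by (subst sum.reindex) (auto simp: inj_on_def)
  also have "\<dots> = (\<Sum>d\<in>S. - moebius d)"
    using moebius_prime_mult(2)[OF p(1)] by (intro sum.cong) (auto simp: S_def)
  finally show ?thesis using False by (simp add: sum_negf)
qed

lemma abs_moebius_le: "\<bar>moebius n\<bar> \<le> 1"
  by (simp add: moebius_def)

lemma abs_summable_moebius:
  fixes f :: "nat \<Rightarrow> complex"
  assumes "norm_summable f A"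
  shows "norm_summable (\<lambda>n. of_int (moebius n) * f n) A"
proof (rule Infinite_Sum.abs_summable_on_comparison_test[OF assms])
  fix n
  have "real_of_int \<bar>moebius n\<bar> \<le> 1" using abs_moebius_le[of n] by linarith
  then show "norm (of_int (moebius n) * f n) \<le> norm (f n)"
    using mult_right_mono[of "real_of_int \<bar>moebius n\<bar>" 1 "norm (f n)"] by (simp add: norm_mult)
qed

text \<open>
The product is a sum over pairs \<open>(d, e)\<close>; grouping the pairs by \<open>n = d e\<close> leaves the divisor sums
of \<open>\<mu>\<close>, which vanish except at \<open>n = 1\<close>.
\<close>

lemma moebius_series_inverse:
  fixes f :: "nat \<Rightarrow> complex"
  assumes f1: "f 1 = 1" and f_mult: "\<And>a b. f (a * b) = f a * f b"
    and summ: "norm_summable f {0<..}"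
  shows "(\<Sum>\<^sub>\<infinity>n\<in>{0<..}. of_int (moebius n) * f n) * (\<Sum>\<^sub>\<infinity>n\<in>{0<..}. f n) = 1"
    (is "?X = 1")
proof -
  have "((\<lambda>(d, e). of_int (moebius d) * f d * f e) has_sum ?X) ({0<..} \<times> {0<..})"
    by (rule has_sum_product[OF abs_summable_moebius[OF summ] summ])
  also have "?this \<longleftrightarrow> ((\<lambda>(n, d). of_int (moebius d) * f n) has_sum ?X) (Sigma {0<..} (\<lambda>n. {d. d dvd n}))"
  proof (rule has_sum_reindex_bij_witness[of _ "\<lambda>(n, d). (d, n div d)" "\<lambda>(d, e). (d * e, d)"])
    fix x :: "nat \<times> nat" assume "x \<in> Sigma {0<..} (\<lambda>n. {d. d dvd n})"
    then show "(case (case x of (n, d) \<Rightarrow> (d, n div d)) of (d, e) \<Rightarrow> (d * e, d)) = x"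
      "(case x of (n, d) \<Rightarrow> (d, n div d)) \<in> {0<..} \<times> {0<..}"
      by (auto elim!: dvdE)
  qed (auto simp: f_mult)
  finally have "((\<lambda>n. \<Sum>d | d dvd n. of_int (moebius d) * f n) has_sum ?X) {0<..}"
    by (rule has_sum_SigmaD) (auto intro!: has_sum_finiteI)
  moreover have "(\<Sum>d | d dvd n. of_int (moebius d) * f n) = of_bool (n = 1)" if "n > 0" for n
  proof -
    have "(\<Sum>d | d dvd n. of_int (moebius d) * f n) = of_int (\<Sum>d | d dvd n. moebius d) * f n"
      by (simp add: sum_distrib_right)
    then show ?thesis using sum_moebius_divisors[OF that] f1 by simp
  qed
  ultimately have "((\<lambda>n::nat. of_bool (n = 1)) has_sum ?X) {0<..}"
    by (subst (asm) has_sum_cong[where g = "\<lambda>n. of_bool (n = 1)"]) auto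
  also have "?this \<longleftrightarrow> ((\<lambda>n. 1) has_sum ?X) {1::nat}"
    by (rule has_sum_cong_neutral) auto
  finally show ?thesis by (simp add: has_sum_finite_iff)
qed

lemma square_part_squarefree_times_square:
  fixes k h :: nat
  assumes "squarefree k" "h > 0"
  shows "square_part (k * h\<^sup>2) = h" "squarefree_part (k * h\<^sup>2) = k"
proof -
  have nz: "k \<noteq> 0" "h \<noteq> 0" using assms by (auto intro!: Nat.gr0I)
  show 1: "square_part (k * h\<^sup>2) = h"
  proof (rule multiplicity_eq_nat)
    show "square_part (k * h\<^sup>2) > 0"
      using nz by (metis square_part_0_iff gr0I mult_eq_0_iff power_eq_0_iff)
    show "h > 0" by (rule assms(2))
  next
    fix p :: nat
    assume p: "prime p"
    have "multiplicity p k \<le> 1"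
      using assms(1) p nz(1) squarefree_factorial_semiring'' by (metis One_nat_def)
    then show "multiplicity p (square_part (k * h\<^sup>2)) = multiplicity p h"
      using p nz
      by (simp add: prime_multiplicity_square_part prime_elem_multiplicity_mult_distrib
          prime_elem_multiplicity_power_distrib)
  qed
  then show "squarefree_part (k * h\<^sup>2) = k"
    using squarefree_decompose[of "k * h\<^sup>2"] nz by simp
qed

text \<open>
Summation over \<open>n = k h\<^sup>2\<close>. The hypothesis on \<open>a\<close> is restricted to the support of \<open>f\<close> because \<open>\<beta>\<close> vanishes
at even arguments; there the weight that selects odd numbers vanishes as well.
\<close>

lemma squarefree_square_series:
  fixes f a c :: "nat \<Rightarrow> complex"
  assumes f_mult: "\<And>a b. f (a * b) = f a * f b"
    and summ: "norm_summable f {0<..}"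
    and c: "norm_summable (\<lambda>h. c h * (f h)\<^sup>2) {0<..}"
    and a: "\<And>k h. squarefree k \<Longrightarrow> h > 0 \<Longrightarrow> f (k * h\<^sup>2) \<noteq> 0 \<Longrightarrow> a (k * h\<^sup>2) = of_int (moebius k) * c h"
  shows "norm_summable (\<lambda>n. a n * f n) {0<..}"
    and "(\<Sum>\<^sub>\<infinity>n\<in>{0<..}. a n * f n) =
      (\<Sum>\<^sub>\<infinity>k\<in>{0<..}. of_int (moebius k) * f k) * (\<Sum>\<^sub>\<infinity>h\<in>{0<..}. c h * (f h)\<^sup>2)"
proof -
  define Q where "Q = {k::nat. squarefree k}"
  let ?j = "\<lambda>(k, h). k * h\<^sup>2 :: nat"
  have Q: "Q \<subseteq> {0<..}" by (auto simp: Q_def intro!: Nat.gr0I)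
  have mf: "norm_summable (\<lambda>k. of_int (moebius k) * f k) Q"
    by (rule abs_summable_moebius[OF summable_on_subset_banach[OF summ Q]])
  have bij: "bij_betw ?j (Q \<times> {0<..}) {0<..}"
  proof (rule bij_betw_byWitness[of _ "\<lambda>n. (squarefree_part n, square_part n)"])
    show "\<forall>x\<in>Q \<times> {0<..}. (squarefree_part (?j x), square_part (?j x)) = x"
      by (auto simp: Q_def square_part_squarefree_times_square)
    show "\<forall>n\<in>{0<..}. ?j (squarefree_part n, square_part n) = n"
      by (simp add: squarefree_decompose[symmetric])
    show "?j ` (Q \<times> {0<..}) \<subseteq> {0<..}" using Q by auto
    show "(\<lambda>n. (squarefree_part n, square_part n)) ` {0<..} \<subseteq> Q \<times> {0<..}"
      by (auto simp: Q_def intro!: Nat.gr0I)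
  qed
  have eq: "a (?j x) * f (?j x) = (case x of (k, h) \<Rightarrow> of_int (moebius k) * f k * (c h * (f h)\<^sup>2))"
    if "x \<in> Q \<times> {0<..}" for x
  proof -
    obtain k h where x: "x = (k, h)" "squarefree k" "h > 0" using \<open>x \<in> _\<close> by (auto simp: Q_def)
    have "f (k * h\<^sup>2) = f k * (f h)\<^sup>2" by (simp add: f_mult power2_eq_square)
    then show ?thesis using a[of k h] x by (cases "f (k * h\<^sup>2) = 0") auto
  qed
  have "(\<lambda>x. norm (a (?j x) * f (?j x))) summable_on Q \<times> {0<..}"
    using has_sum_product(1)[OF mf c] by (rule summable_on_cong[THEN iffD1, rotated]) (simp add: eq)
  then show "norm_summable (\<lambda>n. a n * f n) {0<..}"
    by (subst (asm) summable_on_reindex_bij_betw[OF bij])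
  have "(\<Sum>\<^sub>\<infinity>n\<in>{0<..}. a n * f n) = (\<Sum>\<^sub>\<infinity>x\<in>Q \<times> {0<..}. a (?j x) * f (?j x))"
    by (rule infsum_reindex_bij_betw[OF bij, symmetric])
  also have "\<dots> = (\<Sum>\<^sub>\<infinity>x\<in>Q \<times> {0<..}. case x of (k, h) \<Rightarrow> of_int (moebius k) * f k * (c h * (f h)\<^sup>2))"
    by (rule infsum_cong[OF eq])
  also have "\<dots> = (\<Sum>\<^sub>\<infinity>k\<in>Q. of_int (moebius k) * f k) * (\<Sum>\<^sub>\<infinity>h\<in>{0<..}. c h * (f h)\<^sup>2)"
    by (rule infsumI[OF has_sum_product(2)[OF mf c]])
  also have "(\<Sum>\<^sub>\<infinity>k\<in>Q. of_int (moebius k) * f k) = (\<Sum>\<^sub>\<infinity>k\<in>{0<..}. of_int (moebius k) * f k)"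
    using Q by (intro infsum_cong_neutral) (auto simp: Q_def moebius_def)
  finally show "(\<Sum>\<^sub>\<infinity>n\<in>{0<..}. a n * f n) =
      (\<Sum>\<^sub>\<infinity>k\<in>{0<..}. of_int (moebius k) * f k) * (\<Sum>\<^sub>\<infinity>h\<in>{0<..}. c h * (f h)\<^sup>2)" .
qed

lemma of_nat_mult_powr: "(of_nat (a * b) :: complex) powr s = of_nat a powr s * of_nat b powr s"
proof -
  have "complex_of_real (real a * real b) powr s = of_real (real a) powr s * of_real (real b) powr s"
    unfolding of_real_mult by (rule powr_times_real) auto
  then show ?thesis by simp
qed

lemma bij_betw_Suc_greaterThan_0: "bij_betw Suc UNIV {0<..}"
  by (rule bij_betw_byWitness[of _ "\<lambda>n. n - 1"]) auto

lemma has_sum_zeta_series: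
  assumes "Re s > 1"
  shows "norm_summable (\<lambda>n. of_nat n powr (- s) :: complex) {0<..}"
    and "((\<lambda>n. of_nat n powr (- s)) has_sum zeta_series s) {0<..}"
proof -
  have "(\<lambda>n. norm (of_nat (Suc n) powr (- s) :: complex)) summable_on UNIV"
    using summable_zeta_series[OF assms] by (intro norm_summable_imp_summable_on) simp
  then show "norm_summable (\<lambda>n. of_nat n powr (- s) :: complex) {0<..}"
    by (subst (asm) summable_on_reindex_bij_betw[OF bij_betw_Suc_greaterThan_0])
  have "((\<lambda>n. of_nat (Suc n) powr (- s) :: complex) has_sum zeta_series s) UNIV"
    unfolding zeta_series_def
    using summable_zeta_series[OF assms] summable_norm_cancel[OF summable_zeta_series[OF assms]]
    by (intro norm_summable_imp_has_sum summable_sums)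
  then show "((\<lambda>n. of_nat n powr (- s)) has_sum zeta_series s) {0<..}"
    by (subst (asm) has_sum_reindex_bij_betw[OF bij_betw_Suc_greaterThan_0])
qed

lemma moebius_zeta_series:
  assumes "Re s > 1"
  shows "(\<Sum>\<^sub>\<infinity>n\<in>{0<..}. of_int (moebius n) * of_nat n powr (- s)) * zeta_series s = 1"
  using moebius_series_inverse[OF _ of_nat_mult_powr has_sum_zeta_series(1)[OF assms]]
    infsumI[OF has_sum_zeta_series(2)[OF assms]]
  by simp

lemma liouville_squarefree_times_square:
  assumes "squarefree k" "h > 0"
  shows "liouville (k * h\<^sup>2) = moebius k"
proof -
  have k: "k > 0" using assms(1) by (auto intro!: Nat.gr0I)
  have "prime_factorization k = mset_set (prime_factors k)"
  proof (rule multiset_eqI)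
    fix p
    show "count (prime_factorization k) p = count (mset_set (prime_factors k)) p"
    proof (cases "p \<in> prime_factors k")
      case True
      then have "multiplicity p k = 1"
        using assms(1) squarefree_factorial_semiring'[of k] k by blast
      then show ?thesis using True by (simp add: count_prime_factorization in_prime_factors_imp_prime)
    qed (simp add: not_in_iff)
  qed
  then have "size (prime_factorization k) = card (prime_factors k)" by (metis size_mset_set)
  then have "liouville k = moebius k" using assms(1) by (simp add: liouville_def moebius_def)
  moreover have "liouville h * liouville h = 1"
    by (simp add: liouville_def power_mult_distrib[symmetric])
  ultimately show ?thesis using k assms(2) by (simp add: liouville_mult power2_eq_square)
qed

theorem liouville_series:
  assumes "Re s > 1"
  shows "(\<lambda>n. of_int (liouville (Suc n)) * of_nat (Suc n) powr (- s)) sums (zeta_series (2 * s) / zeta_series s)"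
proof -
  let ?f = "\<lambda>n. of_nat n powr (- s) :: complex"
  note zs = has_sum_zeta_series[OF assms]
  have sq: "1 * (?f h)\<^sup>2 = of_nat h powr (- (2 * s))" for h
    by (simp add: power2_eq_square powr_add[symmetric])
  have z2: "Re (2 * s) > 1" using assms by simp
  have a: "of_int (liouville (k * h\<^sup>2)) = of_int (moebius k) * (1::complex)" if "squarefree k" "h > 0" for k h
    by (simp add: liouville_squarefree_times_square that)
  have c: "norm_summable (\<lambda>h. 1 * (?f h)\<^sup>2) {0<..}"
    unfolding sq by (rule has_sum_zeta_series[OF z2])
  have M: "zeta_series s * (\<Sum>\<^sub>\<infinity>n\<in>{0<..}. of_int (moebius n) * ?f n) = 1"
    using moebius_zeta_series[OF assms] by (simp only: mult.commute)
  have L: "norm_summable (\<lambda>n. of_int (liouville n) * ?f n) {0<..}"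
    "(\<Sum>\<^sub>\<infinity>n\<in>{0<..}. of_int (liouville n) * ?f n) =
      (\<Sum>\<^sub>\<infinity>k\<in>{0<..}. of_int (moebius k) * ?f k) * (\<Sum>\<^sub>\<infinity>h\<in>{0<..}. 1 * (?f h)\<^sup>2)"
    by (rule squarefree_square_series[where f = ?f and c = "\<lambda>_. 1", OF of_nat_mult_powr zs(1) c a]; assumption)+
  have "(\<Sum>\<^sub>\<infinity>n\<in>{0<..}. of_int (liouville n) * ?f n) = zeta_series (2 * s) / zeta_series s"
    unfolding L(2) sq infsumI[OF has_sum_zeta_series(2)[OF z2]] divide_inverse inverse_unique[OF M]
    by (rule mult.commute)
  then have "((\<lambda>n. of_int (liouville n) * ?f n) has_sum zeta_series (2 * s) / zeta_series s) {0<..}"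
    using has_sum_infsum[OF abs_summable_summable[OF L(1)]] by simp
  then have "((\<lambda>n. of_int (liouville (Suc n)) * ?f (Suc n)) has_sum zeta_series (2 * s) / zeta_series s) UNIV"
    by (subst has_sum_reindex_bij_betw[OF bij_betw_Suc_greaterThan_0])
  then show ?thesis by (rule has_sum_imp_sums)
qed

text \<open>
The weight of the series over odd integers, extended by 0 so that it is completely multiplicative on
all natural numbers.
\<close>

definition odd_powr :: "complex \<Rightarrow> nat \<Rightarrow> complex" where
  "odd_powr s n = (if odd n then of_nat n powr (- s) else 0)"

text \<open>
The terms with even index form the whole series multiplied by \<open>2\<close> to the power \<open>-s\<close>.
\<close>

lemma has_sum_odd_powr:
  assumes "Re s > 1"
  shows "norm_summable (odd_powr s) {0<..}"
    and "(\<Sum>\<^sub>\<infinity>n\<in>{0<..}. odd_powr s n) = (1 - 2 powr (- s)) * zeta_series s"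
proof -
  note zs = has_sum_zeta_series[OF assms]
  show 1: "norm_summable (odd_powr s) {0<..}"
    by (rule Infinite_Sum.abs_summable_on_comparison_test[OF zs(1)]) (simp add: odd_powr_def)
  have bij: "bij_betw ((*) 2) {0<..} {n::nat. n > 0 \<and> even n}"
    by (rule bij_betw_byWitness[of _ "\<lambda>n. n div 2"]) (auto elim!: evenE)
  have "((\<lambda>n. 2 powr (- s) * of_nat n powr (- s)) has_sum 2 powr (- s) * zeta_series s) {0<..}"
    by (intro has_sum_cmult_right zs)
  then have "((\<lambda>n. of_nat (2 * n) powr (- s)) has_sum 2 powr (- s) * zeta_series s) {0<..}"
    unfolding of_nat_mult_powr by simp
  then have "((\<lambda>n. of_nat n powr (- s)) has_sum 2 powr (- s) * zeta_series s) {n::nat. n > 0 \<and> even n}"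
    by (subst (asm) has_sum_reindex_bij_betw[OF bij])
  also have "?this \<longleftrightarrow> ((\<lambda>n. of_nat n powr (- s) - odd_powr s n) has_sum 2 powr (- s) * zeta_series s) {0<..}"
    by (rule has_sum_cong_neutral) (auto simp: odd_powr_def)
  finally have "((\<lambda>n. of_nat n powr (- s) + - (of_nat n powr (- s) - odd_powr s n)) has_sum
      zeta_series s + - (2 powr (- s) * zeta_series s)) {0<..}"
    by (intro has_sum_add[OF zs(2)] has_sum_uminusI)
  then show "(\<Sum>\<^sub>\<infinity>n\<in>{0<..}. odd_powr s n) = (1 - 2 powr (- s)) * zeta_series s"
    by (simp add: infsumI algebra_simps)
qed

text \<open>
The squarefree part contributes the reciprocal of the odd zeta series at \<open>w\<close>, and the square part
contributes \<open>h\<close> times \<open>h\<close> to the power \<open>-2w\<close>, that is, the odd zeta series at \<open>2w - 1\<close>.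
\<close>

theorem beta_series:
  assumes "Re w > 1"
  shows "summable (\<lambda>m. norm (of_int (beta (2 * m + 1)) * of_nat (2 * m + 1) powr (- w) :: complex))"
    and "(\<Sum>m. of_int (beta (2 * m + 1)) * of_nat (2 * m + 1) powr (- w)) * ((1 - 2 powr (- w)) * zeta_series w) =
      (1 - 2 powr (1 - 2 * w)) * zeta_series (2 * w - 1)"
proof -
  let ?f = "odd_powr w"
  note zs = has_sum_odd_powr[OF assms]
  have f_mult: "?f (a * b) = ?f a * ?f b" for a b by (simp add: odd_powr_def of_nat_mult_powr[simplified])
  have sq: "of_nat h * (?f h)\<^sup>2 = odd_powr (2 * w - 1) h" for h
  proof (cases "odd h")
    case True
    then have "h \<noteq> 0" using odd_pos by blast
    have "of_nat h * (?f h)\<^sup>2 = of_nat h powr (1 + (- w + - w))"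
      unfolding powr_add using True by (simp add: odd_powr_def power2_eq_square)
    also have "1 + (- w + - w) = - (2 * w - 1)" by simp
    finally show ?thesis using True by (simp add: odd_powr_def)
  qed (simp add: odd_powr_def)
  have w2: "Re (2 * w - 1) > 1" using assms by simp
  have a: "of_int (beta (k * h\<^sup>2)) = of_int (moebius k) * (of_nat h :: complex)"
    if "squarefree k" "h > 0" "?f (k * h\<^sup>2) \<noteq> 0" for k h
  proof -
    have "odd (k * h\<^sup>2)" using that(3) by (auto simp: odd_powr_def split: if_splits)
    then show ?thesis using beta_eq[OF that(1)] by simp
  qed
  have c: "norm_summable (\<lambda>h. of_nat h * (?f h)\<^sup>2) {0<..}"
    unfolding sq by (rule has_sum_odd_powr[OF w2])
  have B: "norm_summable (\<lambda>n. of_int (beta n) * ?f n) {0<..}"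
    "(\<Sum>\<^sub>\<infinity>n\<in>{0<..}. of_int (beta n) * ?f n) =
      (\<Sum>\<^sub>\<infinity>k\<in>{0<..}. of_int (moebius k) * ?f k) * (\<Sum>\<^sub>\<infinity>h\<in>{0<..}. of_nat h * (?f h)\<^sup>2)"
    by (rule squarefree_square_series[where f = ?f and c = of_nat, OF f_mult zs(1) c a]; assumption)+
  have inv: "(\<Sum>\<^sub>\<infinity>n\<in>{0<..}. of_int (moebius n) * ?f n) * ((1 - 2 powr (- w)) * zeta_series w) = 1"
    unfolding zs(2)[symmetric]
    by (rule moebius_series_inverse) (simp_all add: f_mult zs(1), simp add: odd_powr_def)
  have val: "(\<Sum>\<^sub>\<infinity>n\<in>{0<..}. of_int (beta n) * ?f n) * ((1 - 2 powr (- w)) * zeta_series w) =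
     (1 - 2 powr (1 - 2 * w)) * zeta_series (2 * w - 1)" (is "?B * _ = _")
    unfolding B(2) sq has_sum_odd_powr(2)[OF w2] using inv by (simp add: mult_ac)
  let ?g = "\<lambda>m. of_int (beta (2 * m + 1)) * of_nat (2 * m + 1) powr (- w) :: complex"
  have bij: "bij_betw (\<lambda>m. 2 * m + 1) UNIV {n::nat. odd n}"
    by (rule bij_betw_byWitness[of _ "\<lambda>n. n div 2"]) (auto elim!: oddE)
  have "(\<lambda>n. norm (of_int (beta n) * ?f n)) summable_on {n. odd n}"
    by (rule summable_on_subset_banach[OF B(1)]) (auto intro!: Nat.gr0I)
  then have "(\<lambda>m. norm (of_int (beta (2 * m + 1)) * ?f (2 * m + 1))) summable_on UNIV"
    by (subst summable_on_reindex_bij_betw[OF bij])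
  then have "(\<lambda>m. norm (?g m)) summable_on UNIV" by (simp add: odd_powr_def)
  then show "summable (\<lambda>m. norm (?g m))" by (rule summable_on_imp_summable)
  have "((\<lambda>n. of_int (beta n) * ?f n) has_sum ?B) {0<..}"
    by (rule has_sum_infsum[OF abs_summable_summable[OF B(1)]])
  also have "?this \<longleftrightarrow> ((\<lambda>n. of_int (beta n) * ?f n) has_sum ?B) {n. odd n}"
    by (rule has_sum_cong_neutral) (auto simp: odd_powr_def intro!: Nat.gr0I)
  finally have "((\<lambda>m. of_int (beta (2 * m + 1)) * ?f (2 * m + 1)) has_sum ?B) UNIV"
    by (subst has_sum_reindex_bij_betw[OF bij])
  then have "(\<lambda>m. of_int (beta (2 * m + 1)) * ?f (2 * m + 1)) sums ?B" by (rule has_sum_imp_sums)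
  then have "?g sums ?B" by (simp add: odd_powr_def)
  then show "(\<Sum>m. ?g m) * ((1 - 2 powr (- w)) * zeta_series w) =
      (1 - 2 powr (1 - 2 * w)) * zeta_series (2 * w - 1)"
    using val by (simp only: sums_iff)
qed

section \<open>The continued Liouville series left of the critical strip\<close>

lemma zeta_series_nonzero: "Re s > 1 \<Longrightarrow> zeta_series s \<noteq> 0"
  using moebius_zeta_series[of s] by auto

lemma sin_cos_nonzero_left_strip:
  assumes "- (3 / 2) < Re s" "Re s < - (1 / 2)"
  shows "sin (of_real pi * s / 2) \<noteq> 0" "cos (of_real pi * (s + 1 / 2) / 2) \<noteq> 0"
proof -
  have no_int: "Re s \<noteq> 2 * of_int n" "Re s \<noteq> 2 * of_int n + 1 / 2" for n :: int
  proof -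
    have "n \<le> -1 \<or> n \<ge> 0" by linarith
    then have "real_of_int n \<le> -1 \<or> real_of_int n \<ge> 0" by linarith
    then show "Re s \<noteq> 2 * of_int n" "Re s \<noteq> 2 * of_int n + 1 / 2" using assms by linarith+
  qed
  show "sin (of_real pi * s / 2) \<noteq> 0"
  proof
    assume "sin (of_real pi * s / 2) = 0"
    then obtain n :: int where "of_real pi * s / 2 = of_real (n * pi)" unfolding sin_eq_0 by blast
    from arg_cong[OF this, of Re] show False using no_int(1)[of n] by (simp add: field_simps)
  qed
  show "cos (of_real pi * (s + 1 / 2) / 2) \<noteq> 0"
  proof
    assume "cos (of_real pi * (s + 1 / 2) / 2) = 0"
    then obtain n :: int where "of_real pi * (s + 1 / 2) / 2 = of_real (n * pi) + of_real pi / 2"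
      unfolding cos_eq_0 by blast
    from arg_cong[OF this, of Re] have "pi * Re s = pi * (2 * of_int n + 1 / 2)"
      by (simp add: field_simps)
    then show False using no_int(2)[of n] by simp
  qed
qed

text \<open>
The trivial zeros at the negative even integers lie outside the strip, and \<open>1 - s\<close> lies in the
half plane of absolute convergence.
\<close>

lemma riemann_zeta_nonzero_left_strip:
  assumes "- (3 / 2) < Re s" "Re s < - (1 / 2)"
  shows "riemann_zeta s \<noteq> 0"
proof -
  have "1 - s \<notin> \<int>\<^sub>\<le>\<^sub>0" using assms by (auto elim!: nonpos_Ints_cases simp: complex_eq_iff)
  then have "Gamma (1 - s) \<noteq> 0" by (simp add: Gamma_eq_zero_iff)
  moreover have "zeta_series (1 - s) \<noteq> 0" using assms by (intro zeta_series_nonzero) auto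
  ultimately show ?thesis
    using riemann_zeta_functional_equation[of s] sin_cos_nonzero_left_strip(1)[OF assms] assms by simp
qed

lemma riemann_zeta_quotient_analytic:
  assumes "s \<noteq> 1" "2 * s \<noteq> 1" "riemann_zeta s \<noteq> 0"
  shows "(\<lambda>s. riemann_zeta (2 * s) / riemann_zeta s) analytic_on {s}"
proof -
  have "riemann_zeta \<circ> (\<lambda>s. 2 * s) analytic_on {s}"
    using assms(2) by (intro analytic_on_compose) (auto intro!: analytic_intros riemann_zeta_analytic)
  then show ?thesis using assms
    by (intro analytic_on_divide) (auto simp: o_def riemann_zeta_analytic)
qed

text \<open>
Normalising the quotient at its poles and removable singularities makes it nicely meromorphic, so by
uniqueness it is the continuation chosen by the definite description.
\<close>

lemma zeta_liouville_eq_remove_sings: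
  "zeta_liouville = remove_sings (\<lambda>s. riemann_zeta (2 * s) / riemann_zeta s)"
proof -
  let ?L = "\<lambda>s. riemann_zeta (2 * s) / riemann_zeta s"
  have "(\<lambda>s. riemann_zeta (2 * s)) meromorphic_on UNIV"
    by (rule meromorphic_on_compose[OF riemann_zeta_meromorphic]) (auto intro!: analytic_intros)
  then have "?L meromorphic_on UNIV" by (intro meromorphic_intros riemann_zeta_meromorphic)
  then have "remove_sings ?L nicely_meromorphic_on UNIV" by (rule remove_sings_nicely_meromorphic)
  moreover have "(\<lambda>n. of_int (liouville (Suc n)) * of_nat (Suc n) powr (- s)) sums remove_sings ?L s"
    if s: "Re s > 1" for s
  proof -
    have "?L analytic_on {s}"
      using s zeta_series_nonzero[OF s]
      by (intro riemann_zeta_quotient_analytic) (auto simp: riemann_zeta_eq_series complex_eq_iff)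
    then have "remove_sings ?L s = zeta_series (2 * s) / zeta_series s"
      using s by (simp add: riemann_zeta_eq_series)
    then show ?thesis using liouville_series[OF s] by simp
  qed
  ultimately have *: "liouville_continuation (remove_sings ?L)"
    by (simp add: liouville_continuation_def)
  show ?thesis unfolding zeta_liouville_def
    by (rule the_equality, rule *) (rule liouville_continuation_unique[OF _ *])
qed

lemma zeta_liouville_left_strip:
  assumes "- (3 / 2) < Re s" "Re s < - (1 / 2)"
  shows "zeta_liouville s = riemann_zeta (2 * s) / riemann_zeta s"
proof -
  have "s \<noteq> 1" "2 * s \<noteq> 1" using assms by (auto simp: complex_eq_iff)
  then show ?thesis
    unfolding zeta_liouville_eq_remove_sings
    using riemann_zeta_nonzero_left_strip[OF assms]
    by (intro remove_sings_at_analytic riemann_zeta_quotient_analytic)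
qed


section \<open>The integral formula\<close>

text \<open>
The terms are dominated by those of the Dirichlet series of \<open>\<beta>\<close> at \<open>5/2\<close>.
\<close>

lemma summable_liouville_kernel_term:
  assumes "x > 0"
  shows "summable (\<lambda>m. norm (liouville_kernel_term x m))"
proof (rule summable_comparison_test')
  show "summable (\<lambda>m. norm (of_int (beta (2 * m + 1)) * of_nat (2 * m + 1) powr (- (5 / 2)) :: complex))"
    by (rule beta_series) simp
  fix m :: nat
  define n where "n = real (2 * m + 1)"
  have n: "n > 0" by (simp add: n_def)
  have "n powr (5 / 2) = n powr (1 / 2) * n powr 2" unfolding powr_add[symmetric] by simp
  then have powr: "n powr (5 / 2) = sqrt n * n\<^sup>2" using n by (simp add: powr_half_sqrt)
  have "n\<^sup>2 \<le> pi\<^sup>2 * n\<^sup>2" using pi_gt3 by (intro mult_le_cancel_right1[THEN iffD2]) (auto intro!: one_le_power)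
  then have "sqrt n * n\<^sup>2 \<le> sqrt n * (x\<^sup>2 + pi\<^sup>2 * n\<^sup>2)"
    using n by (intro mult_left_mono) (auto intro: add_increasing)
  then have "\<bar>of_int (beta (2 * m + 1))\<bar> / (sqrt n * (x\<^sup>2 + pi\<^sup>2 * n\<^sup>2)) \<le> \<bar>of_int (beta (2 * m + 1))\<bar> / (sqrt n * n\<^sup>2)"
    using n by (intro divide_left_mono mult_pos_pos) (auto intro: add_nonneg_pos)
  moreover have "norm (liouville_kernel_term x m) = \<bar>of_int (beta (2 * m + 1))\<bar> / (sqrt n * (x\<^sup>2 + pi\<^sup>2 * n\<^sup>2))"
    using n unfolding liouville_kernel_term_def n_def[symmetric] by (simp add: abs_mult)
  moreover have "norm (of_int (beta (2 * m + 1)) * of_nat (2 * m + 1) powr (- (5 / 2)) :: complex) =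
      \<bar>of_int (beta (2 * m + 1))\<bar> / (sqrt n * n\<^sup>2)"
  proof -
    have "norm (of_nat (2 * m + 1) powr (- (5 / 2)) :: complex) = n powr (- (5 / 2))"
      using norm_of_nat_Suc_powr[of "2 * m" "- (5 / 2)"] by (simp add: n_def)
    also have "\<dots> = inverse (sqrt n * n\<^sup>2)" unfolding powr_minus powr ..
    finally show ?thesis unfolding norm_mult divide_inverse by (simp only: norm_of_int)
  qed
  ultimately show "norm (norm (liouville_kernel_term x m)) \<le>
      norm (of_int (beta (2 * m + 1)) * of_nat (2 * m + 1) powr (- (5 / 2)) :: complex)"
    by (simp only: real_norm_def abs_abs)
qed

lemma of_real_powr_half: "x \<ge> 0 \<Longrightarrow> complex_of_real x powr (1 / 2) = of_real (sqrt x)"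
  using powr_of_real[of x "1 / 2"] by (simp add: powr_half_sqrt)

theorem has_mellin_liouville_kernel:
  assumes "- (3 / 2) < Re s" "Re s < - (1 / 2)"
  shows "has_mellin (\<lambda>x. of_real (liouville_kernel x)) (s + 1 / 2)
     (of_real pi / 2 / cos (of_real pi * (s + 1 / 2) / 2) * (2 * of_real pi powr (s - 1 / 2) *
       (\<Sum>m. of_int (beta (2 * m + 1)) * of_nat (2 * m + 1) powr (- (1 - s)))))"
proof -
  define n where "n = (\<lambda>m. real (2 * m + 1))"
  \<comment> \<open>\<open>2 x / (x\<^sup>2 + \<pi>\<^sup>2 n\<^sup>2)\<close> is \<open>2 a\<close> times the dilate of \<open>t / (1 + t\<^sup>2)\<close> by \<open>a = 1 / (\<pi> n)\<close>.\<close>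
  define a where "a = (\<lambda>m. 1 / (pi * n m))"
  define c where "c = (\<lambda>m. complex_of_real (2 * of_int (beta (2 * m + 1)) / sqrt (n m) * a m))"
  let ?b = "\<lambda>m. of_int (beta (2 * m + 1)) * of_nat (2 * m + 1) powr (- (1 - s)) :: complex"
  have n: "n m > 0" for m by (simp add: n_def)
  have a: "a m > 0" for m using n[of m] by (simp add: a_def)
  have c_powr: "c m * of_real (a m) powr (- (s + 1 / 2)) = 2 * of_real pi powr (s - 1 / 2) * ?b m" for m
  proof -
    let ?N = "complex_of_real (n m)" and ?p = "complex_of_real pi"
    have "of_real (a m) powr (- (s + 1 / 2)) = of_real (pi * n m) powr (s + 1 / 2)"
      unfolding a_def using n[of m] by (intro inverse_powr_minus) simp
    also have "\<dots> = ?p powr (s + 1 / 2) * ?N powr (s + 1 / 2)"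
      unfolding of_real_mult using n[of m] by (intro powr_times_real) auto
    also have "?p powr (s + 1 / 2) = ?p powr (s - 1 / 2) * ?p"
    proof -
      have "?p powr (s + 1 / 2) = ?p powr ((s - 1 / 2) + 1)" by (simp add: field_simps)
      then show ?thesis unfolding powr_add by simp
    qed
    also have "?N powr (s + 1 / 2) = ?N powr (- (1 - s)) * (of_real (sqrt (n m)) * ?N)"
    proof -
      have "?N powr (s + 1 / 2) = ?N powr (- (1 - s) + (1 / 2 + 1))" by (simp add: field_simps)
      moreover have "?N powr (1 / 2) = of_real (sqrt (n m))"
        using n[of m] by (intro of_real_powr_half) simp
      ultimately show ?thesis unfolding powr_add by (simp add: mult_ac)
    qed
    also have "c m * (?p powr (s - 1 / 2) * ?p * (?N powr (- (1 - s)) * (of_real (sqrt (n m)) * ?N))) =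
        2 * ?p powr (s - 1 / 2) * (of_int (beta (2 * m + 1)) * ?N powr (- (1 - s)))"
      using n[of m] by (simp add: c_def a_def)
    also have "?N = of_nat (2 * m + 1)" by (simp add: n_def)
    finally show ?thesis .
  qed
  have term_eq: "2 * of_int (beta (2 * m + 1)) / sqrt (n m) * a m * (a m * x / (1 + (a m * x)\<^sup>2)) =
      2 * x * liouville_kernel_term x m" if "x > 0" for x m
  proof -
    have "1 + (a m * x)\<^sup>2 = (x\<^sup>2 + pi\<^sup>2 * (n m)\<^sup>2) / (pi * n m)\<^sup>2"
      using n[of m] by (simp add: a_def power_mult_distrib power_divide add_divide_distrib)
    moreover have "real (2 * m + 1) = n m" by (simp add: n_def)
    ultimately show ?thesis
      unfolding liouville_kernel_term_def using n[of m] that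
      by (simp add: a_def power2_eq_square)
  qed
  have cg: "c m * of_real (a m * x / (1 + (a m * x)\<^sup>2)) = of_real (2 * x * liouville_kernel_term x m)"
    if "x > 0" for x m
    unfolding c_def of_real_mult[symmetric] term_eq[OF that] ..
  have "summable (\<lambda>m. norm (?b m))" using assms by (intro beta_series) auto
  then have summ: "summable (\<lambda>m. norm (c m * of_real (a m) powr (- (s + 1 / 2))))"
    unfolding c_powr norm_mult[of "2 * _"] by (rule summable_mult)
  have eval: "(\<Sum>m. c m * of_real (a m * x / (1 + (a m * x)\<^sup>2))) = of_real (liouville_kernel x)" if "x > 0" for x
  proof -
    have "(\<lambda>m. 2 * x * liouville_kernel_term x m) sums liouville_kernel x"
      unfolding liouville_kernel_def using summable_norm_cancel[OF summable_liouville_kernel_term[OF that]]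
      by (intro sums_mult summable_sums)
    then show ?thesis unfolding cg[OF that] by (intro sums_unique[symmetric] sums_of_real)
  qed
  have "has_mellin (\<lambda>x. \<Sum>m. c m * of_real (a m * x / (1 + (a m * x)\<^sup>2))) (s + 1 / 2)
      (of_real pi / 2 / cos (of_real pi * (s + 1 / 2) / 2) * (\<Sum>m. c m * of_real (a m) powr (- (s + 1 / 2))))"
  proof (rule has_mellin_suminf[OF has_mellin_kernel _ summ])
    show "summable (\<lambda>m. norm (c m * of_real (a m * x / (1 + (a m * x)\<^sup>2))))" if "x > 0" for x
    proof -
      have "norm (c m * of_real (a m * x / (1 + (a m * x)\<^sup>2))) = 2 * x * norm (liouville_kernel_term x m)" for m
        unfolding cg[OF that] norm_of_real using that by (simp add: abs_mult)
      then show ?thesis using summable_mult[OF summable_liouville_kernel_term[OF that], of "2 * x"] by simp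
    qed
  qed (use assms a in auto)
  moreover have "(\<Sum>m. c m * of_real (a m) powr (- (s + 1 / 2))) = 2 * of_real pi powr (s - 1 / 2) * (\<Sum>m. ?b m)"
    unfolding c_powr by (rule suminf_mult[OF summable_norm_cancel]) fact
  ultimately show ?thesis
    using has_mellin_cong[OF eval] by (simp only:)
qed

text \<open>
The cancellation that is left once both sides are written out, with \<open>p\<close>, \<open>q\<close> and \<open>r\<close> standing for
\<open>2\<close> to the power \<open>s\<close>, \<open>\<pi>\<close> to the power \<open>s\<close> and \<open>sqrt \<pi>\<close>. The two Euler factor quotients combine to \<open>p\<close>,
and \<open>dup\<close> is Legendre duplication.
\<close>

lemma functional_equation_algebra:
  fixes p q r :: complex
  assumes nz: "p \<noteq> 0" "r \<noteq> 0" "r * r = P" "S \<noteq> 0" "G1 \<noteq> 0" "Z1 \<noteq> 0" "C4 \<noteq> 0"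
    and p2: "p \<noteq> 2" "p\<^sup>2 \<noteq> 2"
    and dup: "G * G1 = p\<^sup>2 * r * G2" and B: "B * ((1 - p / 2) * Z1) = (1 - p\<^sup>2 / 2) * Z2"
  shows "2 * ((p * q)\<^sup>2 / (2 * P)) * (2 * S * C) * G2 * Z2 / (2 * (p * q / (2 * P)) * S * G1 * Z1) =
    (1 - 2 / p) / (1 - 2 / p\<^sup>2) * (2 / p\<^sup>2 / P * C * C4 * G) * (P / 2 / C4 * (2 * (q / r) * B))"
proof -
  have P: "P \<noteq> 0" using nz by auto
  have B': "B = (2 - p\<^sup>2) * Z2 / ((2 - p) * Z1)"
  proof -
    have "B * ((2 - p) * Z1) = 2 * (B * ((1 - p / 2) * Z1))" by (simp add: algebra_simps)
    also have "\<dots> = (2 - p\<^sup>2) * Z2" unfolding B by (simp add: algebra_simps)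
    finally show ?thesis using p2(1) nz(6) by (simp add: eq_divide_eq)
  qed
  have G2: "G2 = G * G1 / (p\<^sup>2 * r)" using dup nz by simp
  have "2 * ((p * q)\<^sup>2 / (2 * P)) * (2 * S * C) * G2 * Z2 / (2 * (p * q / (2 * P)) * S * G1 * Z1) =
      2 * q * C * G * Z2 / (p * r * Z1)"
    unfolding G2 using nz P by (simp add: power2_eq_square mult_ac)
  moreover have "(1 - 2 / p) / (1 - 2 / p\<^sup>2) = p * (2 - p) / (2 - p\<^sup>2)"
  proof -
    have eqs: "1 - 2 / p = - ((2 - p) / p)" "1 - 2 / p\<^sup>2 = - ((2 - p\<^sup>2) / p\<^sup>2)"
      using nz(1) by (simp_all add: field_simps)
    show ?thesis unfolding eqs minus_divide_divide using nz(1) by (simp add: power2_eq_square)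
  qed
  moreover have "p * (2 - p) / (2 - p\<^sup>2) * (2 / p\<^sup>2 / P * C * C4 * G) * (P / 2 / C4 * (2 * (q / r) * B)) =
      2 * q * C * G * Z2 / (p * r * Z1)"
  proof -
    have "2 - p \<noteq> 0" "2 - p\<^sup>2 \<noteq> 0" using p2 by auto
    then show ?thesis unfolding B' using nz P by (simp add: power2_eq_square) (simp add: mult_ac)
  qed
  ultimately show ?thesis by (simp only:)
qed

theorem theorem2:
  fixes s :: complex
  assumes "- (3 / 2) < Re s" and "Re s < - (1 / 2)"
  shows "(\<forall>x>0. summable (liouville_kernel_term x)) \<and>
    set_integrable lborel {0<..}
      (\<lambda>x::real. complex_of_real (liouville_kernel x) * complex_of_real x powr (s - 1 / 2)) \<and>
    zeta_liouville s =
      (1 - 2 powr (1 - s)) / (1 - 2 powr (1 - 2 * s)) * liouville_phi s *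
      (LINT x:{0<..}|lborel. complex_of_real (liouville_kernel x) * complex_of_real x powr (s - 1 / 2))"
proof (intro conjI allI impI)
  fix x :: real assume "x > 0"
  then show "summable (liouville_kernel_term x)"
    by (rule summable_norm_cancel[OF summable_liouville_kernel_term])
next
  define w where "w = 1 - s"
  define B where "B = (\<Sum>m. of_int (beta (2 * m + 1)) * of_nat (2 * m + 1) powr (- w) :: complex)"
  define I where "I = of_real pi / 2 / cos (of_real pi * (s + 1 / 2) / 2) * (2 * of_real pi powr (s - 1 / 2) * B)"
  have "s + 1 / 2 - 1 = s - 1 / 2" by simp
  then have mellin: "has_bochner_integral lborel (\<lambda>x. indicator {0<..} x *\<^sub>R
      (complex_of_real (liouville_kernel x) * complex_of_real x powr (s - 1 / 2))) I"
    using has_mellin_liouville_kernel[OF assms]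
    unfolding has_mellin_def I_def B_def w_def by (simp only: mult.commute)
  then show "set_integrable lborel {0<..}
      (\<lambda>x::real. complex_of_real (liouville_kernel x) * complex_of_real x powr (s - 1 / 2))"
    by (simp add: set_integrable_def has_bochner_integral_iff)
  have int: "(LINT x:{0<..}|lborel. complex_of_real (liouville_kernel x) * complex_of_real x powr (s - 1 / 2)) = I"
    using mellin by (simp add: set_lebesgue_integral_def has_bochner_integral_iff)
  have w: "Re w > 1" using assms by (simp add: w_def)
  define p q r where "p = (2 powr s :: complex)" and "q = complex_of_real pi powr s" and "r = complex_of_real (sqrt pi)"
  have p: "p \<noteq> 0" "norm p < 1"
  proof -
    show "p \<noteq> 0" by (simp add: p_def)
    have "norm p = 2 powr Re s" unfolding p_def by (simp add: norm_powr_real_powr)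
    also have "\<dots> < 1" using assms by (intro powr_less_one) auto
    finally show "norm p < 1" .
  qed
  have p2: "p \<noteq> 2" "p\<^sup>2 \<noteq> 2"
  proof -
    show "p \<noteq> 2" using p(2) by auto
    have "norm (p\<^sup>2) < 1" using p(2) by (simp add: norm_power power_less_one_iff)
    then show "p\<^sup>2 \<noteq> 2" by auto
  qed
  have r: "r \<noteq> 0" "r * r = of_real pi" by (simp_all add: r_def flip: of_real_mult)
  have two_s: "2 powr (2 * s) = p\<^sup>2" "complex_of_real pi powr (2 * s) = q\<^sup>2"
    by (simp_all add: p_def q_def power2_eq_square flip: powr_add)
  have two_pi: "(2 * of_real pi) powr s = p * q" "(2 * of_real pi) powr (2 * s) = (p * q)\<^sup>2"
    unfolding power_mult_distrib two_s[symmetric] unfolding p_def q_def by (subst powr_times_real; simp)+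
  have pws: "2 powr (1 - s) = 2 / p" "2 powr (1 - 2 * s) = 2 / p\<^sup>2"
    "2 powr (- w) = p / 2" "2 powr (1 - 2 * w) = p\<^sup>2 / 2"
    "(2 * of_real pi) powr (s - 1) = p * q / (2 * of_real pi)"
    "(2 * of_real pi) powr (2 * s - 1) = (p * q)\<^sup>2 / (2 * of_real pi)"
    "of_real pi powr (s - 1 / 2) = q / r"
  proof -
    have w': "- w = s - 1" "1 - 2 * w = 2 * s - 1" by (simp_all add: w_def)
    have "complex_of_real pi powr (1 / 2) = r"
      unfolding r_def by (rule of_real_powr_half) simp
    then show "of_real pi powr (s - 1 / 2) = q / r" by (simp add: powr_diff q_def)
    show "2 powr (1 - s) = 2 / p" "2 powr (1 - 2 * s) = 2 / p\<^sup>2"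
      "2 powr (- w) = p / 2" "2 powr (1 - 2 * w) = p\<^sup>2 / 2"
      unfolding w' powr_diff two_s by (simp_all add: p_def)
    show "(2 * of_real pi) powr (s - 1) = p * q / (2 * of_real pi)"
      "(2 * of_real pi) powr (2 * s - 1) = (p * q)\<^sup>2 / (2 * of_real pi)"
      unfolding powr_diff two_pi by simp_all
  qed
  define S C C4 where "S = sin (of_real pi * s / 2)" and "C = cos (of_real pi * s / 2)"
    and "C4 = cos (of_real pi * (s + 1 / 2) / 2)"
  define Z1 Z2 where "Z1 = zeta_series w" and "Z2 = zeta_series (2 * w - 1)"
  define G G1 G2 where "G = Gamma (1 / 2 - s)" and "G1 = Gamma w" and "G2 = Gamma (1 - 2 * s)"
  have dup: "G * G1 = p\<^sup>2 * r * G2"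
  proof -
    have "1 / 2 - s \<notin> \<int>\<^sub>\<le>\<^sub>0" "1 / 2 - s + 1 / 2 \<notin> \<int>\<^sub>\<le>\<^sub>0"
      using assms by (auto elim!: nonpos_Ints_cases simp: complex_eq_iff)
    from Gamma_legendre_duplication[OF this]
    have "G * G1 = exp ((1 - 2 * (1 / 2 - s)) * of_real (ln 2)) * r * G2"
      by (simp add: G_def G1_def G2_def w_def r_def)
    also have "exp ((1 - 2 * (1 / 2 - s)) * of_real (ln 2)) = 2 powr (2 * s)"
      by (simp add: powr_def Ln_of_real[of 2, simplified])
    finally show ?thesis unfolding two_s .
  qed
  have "w \<notin> \<int>\<^sub>\<le>\<^sub>0" using w by (auto elim!: nonpos_Ints_cases)
  then have G1: "G1 \<noteq> 0" by (simp add: G1_def Gamma_eq_zero_iff)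
  have Z1: "Z1 \<noteq> 0" unfolding Z1_def by (rule zeta_series_nonzero[OF w])
  have zeta_s: "riemann_zeta s = 2 * (p * q / (2 * of_real pi)) * S * G1 * Z1"
    using riemann_zeta_functional_equation[of s] assms
    unfolding pws S_def G1_def Z1_def w_def by simp
  have "sin (of_real pi * (2 * s) / 2) = 2 * S * C"
    using sin_double[of "of_real pi * s / 2"] by (simp add: S_def C_def)
  moreover have "2 * w - 1 = 1 - 2 * s" by (simp add: w_def)
  ultimately have zeta_2s: "riemann_zeta (2 * s) = 2 * ((p * q)\<^sup>2 / (2 * of_real pi)) * (2 * S * C) * G2 * Z2"
    using riemann_zeta_functional_equation[of "2 * s"] assms
    unfolding pws G2_def Z2_def by simp
  have args: "of_real pi / 2 * s + of_real pi / 4 = of_real pi * (s + 1 / 2) / 2"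
    "of_real pi / 2 * s = of_real pi * s / 2" by (simp_all add: field_simps)
  have phi: "liouville_phi s = 2 / p\<^sup>2 / of_real pi * C * C4 * G"
    unfolding liouville_phi_def pws C_def C4_def G_def unfolding args(1) unfolding args(2) ..
  have "B * ((1 - p / 2) * Z1) = (1 - p\<^sup>2 / 2) * Z2"
    using beta_series(2)[OF w] unfolding B_def Z1_def Z2_def pws .
  from functional_equation_algebra[OF p(1) r sin_cos_nonzero_left_strip(1)[OF assms, folded S_def] G1 Z1
      sin_cos_nonzero_left_strip(2)[OF assms, folded C4_def] p2 dup this, of q C]
  have "riemann_zeta (2 * s) / riemann_zeta s =
     (1 - 2 powr (1 - s)) / (1 - 2 powr (1 - 2 * s)) * liouville_phi s * I"
    unfolding zeta_s zeta_2s phi I_def C4_def[symmetric] pws .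
  then show "zeta_liouville s =
      (1 - 2 powr (1 - s)) / (1 - 2 powr (1 - 2 * s)) * liouville_phi s *
      (LINT x:{0<..}|lborel. complex_of_real (liouville_kernel x) * complex_of_real x powr (s - 1 / 2))"
    unfolding int zeta_liouville_left_strip[OF assms] .
qed

end
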